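(* There exists a sequence of integers $(d(n))_{n=0}^\infty = 1, 1, -1, 51, 849, -26199, 1341999, \ldots$ (that is, with $d(0)=1$, $d(1)=1$, $d(2)=-1$, $d(3)=51$, $d(4)=849$, $d(5)=-26199$, $d(6)=1341999$) with the property that for all integers $n\ge 0$, $$\theta_3^{(n)}(1) = \theta_3(1)\cdot \frac{(-1)^n}{4^n}\sum_{k=0}^{\lfloor n/2\rfloor} \frac{(2n)!}{2^{n-2k}\,(4k)!\,(n-2k)!}\, d(k)\,\Omega^k .$$
   Context: The Jacobi theta constant is $\theta_3(x)=\sum_{n=-\infty}^\infty e^{-\pi n^2 x}$ for $\operatorname{Re}(x)>0$, and $\theta_3^{(n)}(1)$ is its $n$th derivative at $x=1$. The constant $\Omega$ is $\Omega = \dfrac{\Gamma(1/4)^8}{32\pi^4}$, where $\Gamma$ is the Euler gamma function. *)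

theory Defs
  imports "HOL-Analysis.Analysis"
begin

text \<open>
  The series converges absolutely for \<open>Re x > 0\<close>, so there the unordered sum is the usual
  bilateral sum. For \<open>Re x \<le> 0\<close> the terms are not summable and the value is meaningless.
\<close>

definition theta3 :: "complex \<Rightarrow> complex" where
  "theta3 x = (\<Sum>\<^sub>\<infinity>n\<in>(UNIV :: int set). exp (- (of_real pi * (of_int n)\<^sup>2 * x)))"

definition Omega :: real where
  "Omega = Gamma (1 / 4) ^ 8 / (32 * pi ^ 4)"

end

theory Submission
  imports Defs "HOL-Complex_Analysis.Complex_Analysis" "HOL-Probability.Distributions" "HOL-Probability.Sinc_Integral"
begin

text \<open>
  Every analytic fact about the theta constants is extracted from their doubling formulas, which follow
  from \<open>u\<^sup>2 + v\<^sup>2 = 2 (m\<^sup>2 + n\<^sup>2)\<close> for \<open>u = m + n\<close>, \<open>v = m - n\<close>. Suitable expressions in theta constants and their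
  logarithmic derivatives are invariant, or scale by a constant, under \<open>x \<mapsto> 2 x\<close>, so their behaviour at
  infinity identifies them; this yields the Halphen-Darboux differential system. On the positive reals the
  doubling formulas are the arithmetic-geometric mean iteration. Its strict monotonicity replaces Poisson summation in
  the proof of the functional equation, and Landen's invariance of the complete elliptic integral
  gives \<open>\<Omega> = \<pi>\<^sup>2 \<theta>\<^sub>3(1)\<^sup>8 / 2\<close>.

  With respect to the connection \<open>\<phi> = 2 \<theta>\<^sub>3' / \<theta>\<^sub>3\<close>, for which \<open>\<phi>(1) = - 1 / 2\<close>, the iterated covariant
  derivatives of \<open>\<theta>\<^sub>3\<close> are polynomials in \<open>y = (\<theta>\<^sub>4\<^sup>4 - \<theta>\<^sub>2\<^sup>4) / \<theta>\<^sub>3\<^sup>4\<close>, up to powers of \<open>\<pi>\<close> and \<open>\<theta>\<^sub>3\<close>. After a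
  normalisation by powers of 2 these have integer coefficients and the parity of \<open>n\<close>, and since \<open>y(1) = 0\<close>, the
  constant terms of those of even index are the numbers \<open>d(k)\<close>.
\<close>

section \<open>Nome expansion and two squares\<close>

text \<open>A common limit of two AGM iterations does not identify their starting pairs: the pairs
  with a given mean form a one-parameter family. So the fact that the sequences built from
  \<open>r\<close> and from \<open>1 / r\<close> both tend to 1 does not yet give the functional
  equation. Along the family the first entry falls as the ratio of the entries grows, and Jacobi's
  quartic identity links the ratios at \<open>r\<close> and \<open>1 / r\<close>. About
  \<open>theta3\<close> near 0 only the leading asymptotics then enters, obtained from Riemann sums
  of the Gaussian integral.

  The shape of the final formula reflects the weight 1/2 of \<open>theta3\<close>. The
  \<open>n\<close>-th derivative of a form of weight \<open>k\<close> is the sum over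
  \<open>r\<close> of \<open>(n choose r) (k + r) ... (k + n - 1) \<phi> ^ (n - r)\<close> times the
  \<open>r\<close>-th covariant derivative, corrected by curvature terms. For
  \<open>k = 1 / 2\<close> the product \<open>n! (1/2) (3/2) ... (n - 1/2)\<close> equals
  \<open>(2 n)! / 4 ^ n\<close>; this is the origin of \<open>(2 n)!\<close> and of
  \<open>(4 k)!\<close>, since only even \<open>r = 2 k\<close> survive at the fixed point.\<close>

lemma has_sum_product_complex:
  fixes f :: "'a \<Rightarrow> complex" and g :: "'b \<Rightarrow> complex"
  assumes f: "(f has_sum a) A" and g: "(g has_sum b) B"
  shows "((\<lambda>(x, y). f x * g y) has_sum (a * b)) (A \<times> B)"
proof (rule has_sum_SigmaI)
  show "((\<lambda>y. case (x, y) of (x, y) \<Rightarrow> f x * g y) has_sum f x * b) B" for x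
    using has_sum_cmult_right[OF g] by simp
  show "((\<lambda>x. f x * b) has_sum a * b) A"
    using has_sum_cmult_left[OF f] by simp
  \<comment> \<open>Unordered summability of complex families is absolute, which is what
    interchanging the two summations requires.\<close>
  have sf: "(\<lambda>x. norm (f x)) summable_on A" and sg: "(\<lambda>y. norm (g y)) summable_on B"
    using f g has_sum_imp_summable summable_on_iff_abs_summable_on_complex by blast+
  have "(\<lambda>y. norm (f x) * norm (g y)) summable_on B" for x
    using sg by (rule summable_on_cmult_right)
  moreover have "(\<lambda>x. norm (infsum (\<lambda>y. norm (f x) * norm (g y)) B)) summable_on A"
    using sf sg by (simp add: infsum_cmult_right abs_mult infsum_nonneg summable_on_cmult_left)
  ultimately have "(\<lambda>z. norm (case z of (x, y) \<Rightarrow> f x * g y)) summable_on A \<times> B"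
    using Infinite_Sum.abs_summable_on_Sigma_iff[of "\<lambda>(x, y). f x * g y" A "\<lambda>_. B"] by (simp add: norm_mult)
  then show "(\<lambda>(x, y). f x * g y) summable_on A \<times> B"
    using summable_on_iff_abs_summable_on_complex by blast
qed

definition sq_count :: "nat \<Rightarrow> nat" where
  "sq_count n = card {m::int. nat (m\<^sup>2) = n}"

text \<open>A power series instead of a bilateral sum: holomorphy on the whole disc and the
  derivative at the cusp \<open>q = 0\<close> come at once.\<close>

definition theta_q :: "complex \<Rightarrow> complex" where
  "theta_q q = (\<Sum>n. of_nat (sq_count n) * q ^ n)"

lemma finite_int_sqrt: "finite {m::int. nat (m\<^sup>2) = n}"
proof (rule finite_subset)
  show "{m::int. nat (m\<^sup>2) = n} \<subseteq> {- int n..int n}"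
  proof safe
    fix m :: int
    have "\<bar>m\<bar> * 1 \<le> \<bar>m\<bar> * \<bar>m\<bar>"
      by (cases "m = 0") (auto intro!: mult_left_mono simp del: mult_1_right abs_mult_self_eq)
    then have "\<bar>m\<bar> \<le> m\<^sup>2" by (simp add: power2_eq_square)
    then show "m \<in> {- int (nat (m\<^sup>2))..int (nat (m\<^sup>2))}" by auto
  qed
qed simp

lemma sq_count_simps [simp]: "sq_count 0 = 1" "sq_count (Suc 0) = 2"
proof -
  have "{m::int. nat (m\<^sup>2) = 0} = {0}" by auto
  then show "sq_count 0 = 1" by (simp add: sq_count_def)
  have "{m::int. nat (m\<^sup>2) = Suc 0} = {1, -1}"
  proof -
    have "nat (m\<^sup>2) = Suc 0 \<longleftrightarrow> m\<^sup>2 = 1" for m :: int by linarith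
    then show ?thesis by (auto simp only: power2_eq_1_iff)
  qed
  then have "sq_count (Suc 0) = card {1, -1::int}" by (simp only: sq_count_def)
  then show "sq_count (Suc 0) = 2" by simp
qed

lemma int_range_split: "(UNIV::int set) = range int \<union> range (\<lambda>n. - int n)"
proof -
  have "m \<in> range int \<union> range (\<lambda>n. - int n)" for m
    by (cases m rule: int_cases2) auto
  then show ?thesis by blast
qed

lemma summable_int_squares:
  fixes r :: real
  assumes "0 \<le> r" "r < 1"
  shows "(\<lambda>m::int. r ^ nat (m\<^sup>2)) summable_on UNIV"
proof -
  have le: "r ^ n\<^sup>2 \<le> r ^ n" for n :: nat
    using assms by (intro power_decreasing) (auto simp: power2_eq_square)
  have "summable (\<lambda>n. r ^ n)" using assms by (simp add: summable_geometric)
  then have "summable (\<lambda>n. r ^ n\<^sup>2)"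
    by (rule summable_comparison_test[rotated]) (use le assms in auto)
  then have *: "(\<lambda>n. r ^ n\<^sup>2) summable_on UNIV"
    using assms by (subst summable_on_UNIV_nonneg_real_iff) auto
  have e: "nat ((int n)\<^sup>2) = n\<^sup>2" for n by (metis nat_int of_nat_power)
  have "(\<lambda>m::int. r ^ nat (m\<^sup>2)) summable_on (range int)"
    by (subst summable_on_reindex) (use * e in \<open>auto simp: o_def inj_def\<close>)
  moreover have "(\<lambda>m::int. r ^ nat (m\<^sup>2)) summable_on (range (\<lambda>n. - int n))"
    by (subst summable_on_reindex) (use * e in \<open>auto simp: o_def inj_def\<close>)
  ultimately show ?thesis
    unfolding int_range_split by (rule summable_on_union)
qed

lemma summable_int_squares_complex:
  assumes "norm (q::complex) < 1"
  shows "(\<lambda>m::int. q ^ nat (m\<^sup>2)) summable_on UNIV"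
  using summable_int_squares[of "norm q"] assms
  by (simp add: summable_on_iff_abs_summable_on_complex norm_power)

lemma theta_q_sums_has_sum:
  assumes "norm q < 1"
  shows "(\<lambda>n. of_nat (sq_count n) * q ^ n) sums theta_q q"
    and "((\<lambda>m::int. q ^ nat (m\<^sup>2)) has_sum theta_q q) UNIV"
proof -
  define S where "S = infsum (\<lambda>m::int. q ^ nat (m\<^sup>2)) UNIV"
  have S: "((\<lambda>m::int. q ^ nat (m\<^sup>2)) has_sum S) UNIV"
    unfolding S_def using summable_int_squares_complex[OF assms] by simp
  \<comment> \<open>The integers are grouped by the value of their square; the group of
    \<open>n\<close> is finite with \<open>sq_count n\<close> elements.\<close>
  have "((\<lambda>(n, m). q ^ n) has_sum S) (SIGMA n:UNIV. {m::int. nat (m\<^sup>2) = n})"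
    using S by (subst has_sum_reindex_bij_witness[of UNIV snd "\<lambda>m. (nat (m\<^sup>2), m)", symmetric]) auto
  then have "((\<lambda>n. of_nat (sq_count n) * q ^ n) has_sum S) UNIV"
    by (rule has_sum_SigmaD) (use finite_int_sqrt in \<open>auto simp: sq_count_def intro!: has_sum_finiteI\<close>)
  then have *: "(\<lambda>n. of_nat (sq_count n) * q ^ n) sums S"
    by (rule has_sum_imp_sums)
  then have "S = theta_q q" by (simp add: theta_q_def sums_iff)
  with * S show "(\<lambda>n. of_nat (sq_count n) * q ^ n) sums theta_q q"
    and "((\<lambda>m::int. q ^ nat (m\<^sup>2)) has_sum theta_q q) UNIV" by auto
qed

lemma theta_q_holomorphic: "theta_q holomorphic_on ball 0 1"
  by (rule power_series_holomorphic[where a = "\<lambda>n. of_nat (sq_count n)"])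
     (use theta_q_sums_has_sum(1) in auto)

lemma theta_q_0: "theta_q 0 = 1"
  unfolding theta_q_def by simp

lemma deriv_theta_q_0: "deriv theta_q 0 = 2"
proof -
  have "(theta_q has_field_derivative (\<Sum>n. diffs (\<lambda>n. of_nat (sq_count n)) n * 0 ^ n)) (at 0)"
    unfolding theta_q_def[abs_def]
    by (rule termdiffs_strong'[where K = 1])
       (use theta_q_sums_has_sum(1) in \<open>auto intro: sums_summable\<close>)
  then show ?thesis by (simp add: DERIV_imp_deriv diffs_def)
qed

text \<open>For \<open>q = nome x\<close> the even part is \<open>theta3 (4 * x)\<close> and the odd
  part is \<open>theta2 (4 * x)\<close>; parity classes are what the rotation of the square lattice
  preserves.\<close>

lemma theta_q_even_odd:
  assumes "norm q < 1"
  shows "((\<lambda>m::int. q ^ nat (m\<^sup>2)) has_sum theta_q (q ^ 4)) {m. even m}"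
    and "((\<lambda>m::int. q ^ nat (m\<^sup>2)) has_sum (theta_q q - theta_q (q ^ 4))) {m. odd m}"
proof -
  have q4: "norm (q ^ 4) < 1"
    using assms by (simp add: norm_power power_less_one_iff)
  have e: "q ^ nat ((2 * m)\<^sup>2) = (q ^ 4) ^ nat (m\<^sup>2)" for m :: int
    unfolding power_mult_distrib by (simp add: nat_mult_distrib power_mult)
  show 1: "((\<lambda>m::int. q ^ nat (m\<^sup>2)) has_sum theta_q (q ^ 4)) {m. even m}"
    using theta_q_sums_has_sum(2)[OF q4]
    by (subst has_sum_reindex_bij_witness[of UNIV "\<lambda>m. m div 2" "\<lambda>m. 2 * m", symmetric])
       (use e in auto)
  have "((\<lambda>m::int. q ^ nat (m\<^sup>2)) has_sum (theta_q q - theta_q (q ^ 4))) (UNIV - {m. even m})"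
    by (rule has_sum_Diff[OF theta_q_sums_has_sum(2)[OF assms] 1]) auto
  also have "UNIV - {m::int. even m} = {m. odd m}" by auto
  finally show "((\<lambda>m::int. q ^ nat (m\<^sup>2)) has_sum (theta_q q - theta_q (q ^ 4))) {m. odd m}" .
qed

text \<open>The map \<open>(m, n) \<mapsto> (m + n, m - n)\<close> sends \<open>\<int>\<^sup>2\<close> onto the pairs of equal parity and doubles the sum of squares.\<close>

lemma theta_q_two_squares:
  assumes q: "norm q < 1"
  shows "(theta_q (q\<^sup>2))\<^sup>2 = (theta_q (q ^ 4))\<^sup>2 + (theta_q q - theta_q (q ^ 4))\<^sup>2"
proof -
  let ?E = "{m::int. even m}" and ?O = "{m::int. odd m}"
  let ?f = "\<lambda>(u::int, v::int). q ^ nat (u\<^sup>2) * q ^ nat (v\<^sup>2)"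
  have q2: "norm (q\<^sup>2) < 1" using q by (simp add: norm_power power_less_one_iff)
  have "(?f has_sum theta_q (q ^ 4) * theta_q (q ^ 4)) (?E \<times> ?E)"
    by (rule has_sum_product_complex) (rule theta_q_even_odd[OF q])+
  moreover have "(?f has_sum (theta_q q - theta_q (q ^ 4)) * (theta_q q - theta_q (q ^ 4))) (?O \<times> ?O)"
    by (rule has_sum_product_complex) (rule theta_q_even_odd[OF q])+
  ultimately have 1: "(?f has_sum ((theta_q (q ^ 4))\<^sup>2 + (theta_q q - theta_q (q ^ 4))\<^sup>2)) (?E \<times> ?E \<union> ?O \<times> ?O)"
    unfolding power2_eq_square by (rule has_sum_Un_disjoint) auto
  have 2: "((\<lambda>(m::int, n::int). (q\<^sup>2) ^ nat (m\<^sup>2) * (q\<^sup>2) ^ nat (n\<^sup>2)) has_sum (theta_q (q\<^sup>2) * theta_q (q\<^sup>2))) (UNIV \<times> UNIV)"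
    by (rule has_sum_product_complex) (rule theta_q_sums_has_sum[OF q2])+
  have e: "?f (m + n, m - n) = (q\<^sup>2) ^ nat (m\<^sup>2) * (q\<^sup>2) ^ nat (n\<^sup>2)" for m n :: int
  proof -
    have "int (nat ((m + n)\<^sup>2) + nat ((m - n)\<^sup>2)) = int (2 * nat (m\<^sup>2) + 2 * nat (n\<^sup>2))"
      by (simp only: of_nat_add of_nat_mult int_nat_eq zero_le_power2 if_True)
         (simp add: power2_eq_square algebra_simps)
    then have "nat ((m + n)\<^sup>2) + nat ((m - n)\<^sup>2) = 2 * nat (m\<^sup>2) + 2 * nat (n\<^sup>2)"
      by (simp only: of_nat_eq_iff)
    then show ?thesis by (simp flip: power_add power_mult)
  qed
  have "(?f has_sum (theta_q (q\<^sup>2) * theta_q (q\<^sup>2))) (?E \<times> ?E \<union> ?O \<times> ?O)"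
    using 2
  proof (subst has_sum_reindex_bij_witness[of "UNIV \<times> UNIV" "\<lambda>(u, v). ((u + v) div 2, (u - v) div 2)"
          "\<lambda>(m, n). (m + n, m - n)", symmetric])
    fix a :: "int \<times> int"
    show "?f (case a of (m, n) \<Rightarrow> (m + n, m - n)) =
          (case a of (m, n) \<Rightarrow> (q\<^sup>2) ^ nat (m\<^sup>2) * (q\<^sup>2) ^ nat (n\<^sup>2))"
      using e[of "fst a" "snd a"] by (cases a) simp
  next
    fix b :: "int \<times> int"
    assume b: "b \<in> ?E \<times> ?E \<union> ?O \<times> ?O"
    obtain u v where uv: "b = (u, v)" by (cases b)
    with b have "even (u + v)" "even (u - v)" by auto
    then have "(u + v) div 2 + (u - v) div 2 = u" "(u + v) div 2 - (u - v) div 2 = v" by presburger+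
    then show "(case case b of (u, v) \<Rightarrow> ((u + v) div 2, (u - v) div 2) of (m, n) \<Rightarrow> (m + n, m - n)) = b"
      by (simp add: uv)
  qed auto
  from has_sum_unique[OF this 1] show ?thesis by (simp add: power2_eq_square)
qed

section \<open>Doubling formulas\<close>

abbreviation rhp :: "complex set" where "rhp \<equiv> {x. 0 < Re x}"

text \<open>In terms of series, \<open>theta2 x\<close> is the sum of \<open>exp (- \<pi> n\<^sup>2 x / 4)\<close> over odd \<open>n\<close>, and
  \<open>theta4 x\<close> that of \<open>(- 1)\<^sup>n exp (- \<pi> n\<^sup>2 x)\<close>.\<close>

definition theta2 :: "complex \<Rightarrow> complex" where
  "theta2 x = theta3 (x / 4) - theta3 x"

definition theta4 :: "complex \<Rightarrow> complex" where
  "theta4 x = 2 * theta3 (4 * x) - theta3 x"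

definition nome :: "complex \<Rightarrow> complex" where
  "nome x = exp (- (of_real pi * x))"

lemma nome_nonzero [simp]: "nome x \<noteq> 0"
  by (simp add: nome_def)

lemma norm_nome: "norm (nome x) = exp (- (pi * Re x))"
  by (simp add: nome_def)

lemma norm_nome_less_1: "0 < Re x \<Longrightarrow> norm (nome x) < 1"
  by (simp add: norm_nome)

lemma nome_mult: "nome (of_nat n * x) = nome x ^ n"
  by (simp add: nome_def mult_ac flip: exp_of_nat_mult)

lemma nome_mult_numeral: "nome (numeral k * x) = nome x ^ numeral k"
  using nome_mult[of "numeral k" x] by simp

lemma open_rhp [simp]: "open rhp"
  by (rule open_halfspace_Re_gt)

lemma theta3_conv_theta_q:
  assumes "0 < Re x"
  shows "theta3 x = theta_q (nome x)"
proof -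
  have "exp (- (of_real pi * (of_int n)\<^sup>2 * x)) = nome x ^ nat (n\<^sup>2)" for n :: int
  proof -
    have "(of_int n :: complex)\<^sup>2 = of_nat (nat (n\<^sup>2))"
      by (simp add: of_nat_nat)
    then show ?thesis
      unfolding nome_def by (simp add: mult_ac flip: exp_of_nat_mult)
  qed
  then show ?thesis
    unfolding theta3_def
    using infsumI[OF theta_q_sums_has_sum(2)[OF norm_nome_less_1[OF assms]]] by simp
qed

lemma nome_holomorphic: "nome holomorphic_on A"
  unfolding nome_def[abs_def] by (intro holomorphic_intros)

lemma theta3_holomorphic: "theta3 holomorphic_on rhp"
proof (rule holomorphic_transform)
  show "(theta_q \<circ> nome) holomorphic_on rhp"
    by (rule holomorphic_on_compose_gen[OF nome_holomorphic theta_q_holomorphic])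
       (auto simp: norm_nome_less_1)
qed (auto simp: theta3_conv_theta_q)

lemma theta2_holomorphic: "theta2 holomorphic_on rhp"
proof -
  have "(theta3 \<circ> (\<lambda>x. x / 4)) holomorphic_on rhp"
    by (rule holomorphic_on_compose_gen[OF _ theta3_holomorphic]) (auto intro!: holomorphic_intros)
  then show ?thesis
    unfolding theta2_def[abs_def] o_def by (intro holomorphic_intros theta3_holomorphic)
qed

lemma theta4_holomorphic: "theta4 holomorphic_on rhp"
proof -
  have "(theta3 \<circ> (\<lambda>x. 4 * x)) holomorphic_on rhp"
    by (rule holomorphic_on_compose_gen[OF _ theta3_holomorphic]) (auto intro!: holomorphic_intros)
  then show ?thesis
    unfolding theta4_def[abs_def] o_def by (intro holomorphic_intros theta3_holomorphic)
qed

lemma DERIV_theta: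
  assumes "0 < Re x"
  shows "(theta2 has_field_derivative deriv theta2 x) (at x)"
    and "(theta3 has_field_derivative deriv theta3 x) (at x)"
    and "(theta4 has_field_derivative deriv theta4 x) (at x)"
  using holomorphic_derivI[OF theta2_holomorphic open_rhp] holomorphic_derivI[OF theta3_holomorphic open_rhp]
    holomorphic_derivI[OF theta4_holomorphic open_rhp] assms by auto

text \<open>As \<open>theta2\<close> and \<open>theta4\<close> are linear combinations of
  \<open>theta3\<close> at scaled arguments, all doubling formulas follow algebraically from this
  relation, taken at \<open>x\<close>, \<open>2 * x\<close> and \<open>x / 2\<close>.\<close>

lemma theta3_two_squares:
  assumes "0 < Re x"
  shows "(theta3 (2 * x))\<^sup>2 = (theta3 (4 * x))\<^sup>2 + (theta3 x - theta3 (4 * x))\<^sup>2"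
  using theta_q_two_squares[OF norm_nome_less_1[OF assms]] assms
  by (simp add: theta3_conv_theta_q nome_mult_numeral)

lemma theta3_double:
  assumes "0 < Re x"
  shows "(theta3 (2 * x))\<^sup>2 = ((theta3 x)\<^sup>2 + (theta4 x)\<^sup>2) / 2"
  using theta3_two_squares[OF assms] unfolding theta4_def by algebra

lemma theta4_double:
  assumes "0 < Re x"
  shows "(theta4 (2 * x))\<^sup>2 = theta3 x * theta4 x"
  using theta3_two_squares[OF assms] theta3_two_squares[of "2 * x"] assms
  unfolding theta4_def by (simp add: mult.assoc[symmetric]) algebra

lemma theta2_double:
  assumes "0 < Re x"
  shows "(theta2 (2 * x))\<^sup>2 = ((theta3 x)\<^sup>2 - (theta4 x)\<^sup>2) / 2"
  using theta3_two_squares[OF assms] theta3_two_squares[of "x / 2"] assms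
  unfolding theta4_def theta2_def by simp algebra

text \<open>\<open>theta2_double\<close> at \<open>x / 2\<close> contains a difference of two
  squares, whose factors \<open>theta3 (x / 2) + theta4 (x / 2)\<close> and
  \<open>theta3 (x / 2) - theta4 (x / 2)\<close> are \<open>2 * theta3 (2 * x)\<close> and
  \<open>2 * theta2 (2 * x)\<close>.\<close>

lemma theta2_half:
  assumes "0 < Re x"
  shows "(theta2 x)\<^sup>2 = 2 * theta3 (2 * x) * theta2 (2 * x)"
proof -
  have "(theta2 x)\<^sup>2 = ((theta3 (x / 2))\<^sup>2 - (theta4 (x / 2))\<^sup>2) / 2"
    using theta2_double[of "x / 2"] assms by simp
  then show ?thesis unfolding theta4_def theta2_def by simp algebra
qed

text \<open>Squaring \<open>theta2_half\<close> leaves the squares of \<open>theta3 (2 * x)\<close>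
  and \<open>theta2 (2 * x)\<close>, that is, half the sum and half the difference of
  \<open>theta3 x ^ 2\<close> and \<open>theta4 x ^ 2\<close>.\<close>

lemma jacobi_quartic:
  assumes "0 < Re x"
  shows "(theta3 x) ^ 4 = (theta2 x) ^ 4 + (theta4 x) ^ 4"
  using theta2_half[OF assms] theta2_double[OF assms] theta3_double[OF assms] by algebra

section \<open>Behaviour at infinity and absence of zeros\<close>

abbreviation at_right_infinity :: "complex filter" where
  "at_right_infinity \<equiv> filtercomap Re at_top"

lemma eventually_Re_pos: "eventually (\<lambda>x. 0 < Re x) at_right_infinity"
  by (rule eventually_filtercomapI[OF eventually_gt_at_top])

lemma nome_tendsto_0: "(nome \<longlongrightarrow> 0) at_right_infinity"
proof (rule tendsto_norm_zero_cancel)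
  have "((\<lambda>r::real. exp (- (pi * r))) \<longlongrightarrow> 0) at_top"
    by real_asymp
  then have "((\<lambda>x. exp (- (pi * Re x))) \<longlongrightarrow> 0) at_right_infinity"
    by (rule filterlim_compose[OF _ filterlim_filtercomap])
  then show "((\<lambda>x. norm (nome x)) \<longlongrightarrow> 0) at_right_infinity"
    by (simp add: norm_nome)
qed

lemma nome_at_0: "filterlim nome (at 0) at_right_infinity"
  using nome_tendsto_0 by (simp add: filterlim_at)

lemma Re_pow2: "Re (2 ^ n * x) = 2 ^ n * Re x"
  by (metis of_real_numeral of_real_power Re_complex_of_real times_complex.simps(1) Im_complex_of_real mult_zero_left diff_zero)

text \<open>The filter constrains only the real part, so the doubling orbit of every point of the
  half-plane converges along it, whatever its imaginary part.\<close>

lemma filterlim_pow2_mult: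
  assumes "0 < Re x"
  shows "filterlim (\<lambda>n. 2 ^ n * x) at_right_infinity sequentially"
proof -
  have "filterlim (\<lambda>n. 2 ^ n * Re x) at_top sequentially"
    using assms by real_asymp
  then show ?thesis by (simp add: filterlim_filtercomap_iff o_def Re_pow2)
qed

lemma Re_pow2_mult: "0 < Re x \<Longrightarrow> 0 < Re (2 ^ n * x)"
  by (simp add: Re_pow2)

lemma theta_q_isCont: "norm q < 1 \<Longrightarrow> isCont theta_q q"
  using theta_q_holomorphic holomorphic_on_imp_continuous_on continuous_on_eq_continuous_at open_ball
  by (metis mem_ball_0)

lemma theta_q_tendsto: "(theta_q \<longlongrightarrow> 1) (nhds 0)"
  using theta_q_isCont[of 0] tendsto_at_iff_tendsto_nhds[of theta_q 0] by (simp add: isCont_def theta_q_0)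

lemma theta_q_quotient_tendsto: "((\<lambda>q. (theta_q q - 1) / q) \<longlongrightarrow> 2) (at 0)"
  using holomorphic_derivI[OF theta_q_holomorphic, of 0 UNIV]
  by (simp add: deriv_theta_q_0 DERIV_def theta_q_0)

lemma theta3_tendsto: "(theta3 \<longlongrightarrow> 1) at_right_infinity"
proof (rule Lim_transform_eventually)
  show "((\<lambda>x. theta_q (nome x)) \<longlongrightarrow> 1) at_right_infinity"
    by (rule filterlim_compose[OF theta_q_tendsto nome_tendsto_0])
  show "\<forall>\<^sub>F x in at_right_infinity. theta_q (nome x) = theta3 x"
    using eventually_Re_pos by eventually_elim (simp add: theta3_conv_theta_q)
qed

lemma filterlim_mult_at_right_infinity:
  "filterlim (\<lambda>x. numeral k * x) at_right_infinity at_right_infinity"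
proof -
  have "filterlim (\<lambda>r::real. numeral k * r) at_top at_top" by real_asymp
  then have "filterlim (\<lambda>x. numeral k * Re x) at_top at_right_infinity"
    by (rule filterlim_compose[OF _ filterlim_filtercomap])
  then show ?thesis by (simp add: filterlim_filtercomap_iff o_def)
qed

lemma theta4_tendsto: "(theta4 \<longlongrightarrow> 1) at_right_infinity"
proof -
  have "((\<lambda>x. 2 * theta3 (4 * x) - theta3 x) \<longlongrightarrow> 2 * 1 - 1) at_right_infinity"
    by (intro tendsto_intros theta3_tendsto filterlim_compose[OF theta3_tendsto filterlim_mult_at_right_infinity])
  then show ?thesis by (simp add: theta4_def[abs_def])
qed

text \<open>\<open>theta2 x\<close> is a series in the fourth root of the nome. At
  \<open>4 * x\<close> it becomes \<open>theta_q q - theta_q (q ^ 4) = 2 q + ...\<close> with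
  \<open>q = nome x\<close>, and no branch has to be chosen.\<close>

lemma theta2_quotient_tendsto:
  "((\<lambda>x. theta2 (4 * x) / nome x) \<longlongrightarrow> 2) at_right_infinity"
proof (rule Lim_transform_eventually)
  have 1: "((\<lambda>x. (theta_q (nome x) - 1) / nome x) \<longlongrightarrow> 2) at_right_infinity"
    by (rule filterlim_compose[OF theta_q_quotient_tendsto nome_at_0])
  have "((\<lambda>x. (theta_q (nome (4 * x)) - 1) / nome (4 * x)) \<longlongrightarrow> 2) at_right_infinity"
    by (rule filterlim_compose[OF 1 filterlim_mult_at_right_infinity])
  then have 2: "((\<lambda>x. (nome x) ^ 3 * ((theta_q (nome (4 * x)) - 1) / nome (4 * x))) \<longlongrightarrow> 0 ^ 3 * 2) at_right_infinity"
    by (intro tendsto_intros nome_tendsto_0)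
  show "((\<lambda>x. (theta_q (nome x) - 1) / nome x - (nome x) ^ 3 * ((theta_q (nome (4 * x)) - 1) / nome (4 * x))) \<longlongrightarrow> 2) at_right_infinity"
    using tendsto_diff[OF 1 2] by simp
  show "\<forall>\<^sub>F x in at_right_infinity. (theta_q (nome x) - 1) / nome x - (nome x) ^ 3 * ((theta_q (nome (4 * x)) - 1) / nome (4 * x)) = theta2 (4 * x) / nome x"
    using eventually_Re_pos
  proof eventually_elim
    case (elim x)
    have "(nome x) ^ 3 * (w / nome x ^ 4) = w / nome x" for w
      by (simp add: field_simps power3_eq_cube power4_eq_xxxx)
    then show ?case using elim
      by (simp add: theta2_def theta3_conv_theta_q nome_mult_numeral flip: diff_divide_distrib)
  qed
qed

text \<open>By the doubling formulas, a zero at \<open>x\<close> forces zeros at all \<open>2\<^sup>n x\<close>, against the limits at infinity.\<close>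

lemma theta4_nonzero:
  assumes "0 < Re x"
  shows "theta4 x \<noteq> 0"
proof
  assume "theta4 x = 0"
  then have "theta4 (2 ^ n * x) = 0" for n
  proof (induction n)
    case (Suc n)
    then show ?case
      using theta4_double[OF Re_pow2_mult[OF assms], of n] by (simp add: mult.assoc)
  qed simp
  moreover have "((\<lambda>n. theta4 (2 ^ n * x)) \<longlongrightarrow> 1) sequentially"
    by (rule filterlim_compose[OF theta4_tendsto filterlim_pow2_mult[OF assms]])
  ultimately show False by (simp add: LIMSEQ_const_iff)
qed

lemma theta3_nonzero: "0 < Re x \<Longrightarrow> theta3 x \<noteq> 0"
  using theta4_double[of x] theta4_nonzero[of "2 * x"] by auto

lemma theta2_nonzero:
  assumes "0 < Re x"
  shows "theta2 x \<noteq> 0"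
proof
  assume "theta2 x = 0"
  then have z: "theta2 (2 ^ n * x) = 0" for n
  proof (induction n)
    case (Suc n)
    have "theta3 (2 * (2 ^ n * x)) \<noteq> 0"
      using Re_pow2_mult[OF assms, of "Suc n"] by (intro theta3_nonzero) (simp add: mult.assoc)
    with Suc show ?case
      using theta2_half[OF Re_pow2_mult[OF assms], of n] by (simp add: mult.assoc)
  qed simp
  \<comment> \<open>\<open>theta2\<close> itself tends to 0, so the contradiction has to come from
    its leading coefficient.\<close>
  have "((\<lambda>n. theta2 (4 * (2 ^ n * x)) / nome (2 ^ n * x)) \<longlongrightarrow> 2) sequentially"
    by (rule filterlim_compose[OF theta2_quotient_tendsto filterlim_pow2_mult[OF assms]])
  moreover have "theta2 (4 * (2 ^ n * x)) = 0" for n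
    using z[of "n + 2"] by (simp add: mult.assoc)
  ultimately show False by (simp add: LIMSEQ_const_iff)
qed

lemma theta_square_double:
  assumes "0 < Re x"
  shows "(theta3 x)\<^sup>2 + (theta4 x)\<^sup>2 = 2 * (theta3 (2 * x))\<^sup>2"
    and "(theta3 x)\<^sup>2 - (theta4 x)\<^sup>2 = 2 * (theta2 (2 * x))\<^sup>2"
  by (simp_all add: theta3_double[OF assms] theta2_double[OF assms])

lemmas theta_nonzero = theta2_nonzero theta3_nonzero theta4_nonzero

section \<open>Differential equations\<close>

definition logderiv :: "(complex \<Rightarrow> complex) \<Rightarrow> complex \<Rightarrow> complex" where
  "logderiv f x = deriv f x / f x"

lemma deriv_square_double:
  assumes x: "0 < Re x" and f: "(f has_field_derivative f') (at (2 * x))"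
    and eq: "\<And>y. 0 < Re y \<Longrightarrow> (f (2 * y))\<^sup>2 = h y" and h: "(h has_field_derivative h') (at x)"
  shows "4 * f (2 * x) * f' = h'"
proof -
  have "((\<lambda>y. 2 * y) has_field_derivative 2) (at x)"
    by (auto intro!: derivative_eq_intros)
  from DERIV_chain2[OF f this] have "((\<lambda>y. (f (2 * y))\<^sup>2) has_field_derivative 4 * f (2 * x) * f') (at x)"
    by (auto intro!: derivative_eq_intros)
  then have "(h has_field_derivative 4 * f (2 * x) * f') (at x)"
    by (rule has_field_derivative_transform_within_open[where S = rhp]) (use x eq in auto)
  with h show ?thesis by (rule DERIV_unique[rotated])
qed

lemma logderiv_theta4_double:
  assumes x: "0 < Re x"
  shows "logderiv theta4 (2 * x) = (logderiv theta3 x + logderiv theta4 x) / 4"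
proof -
  have x2: "0 < Re (2 * x)" using x by simp
  have "4 * theta4 (2 * x) * deriv theta4 (2 * x) = deriv theta3 x * theta4 x + deriv theta4 x * theta3 x"
    by (rule deriv_square_double[OF x DERIV_theta(3)[OF x2] theta4_double])
       (use DERIV_mult[OF DERIV_theta(2,3)[OF x]] in auto)
  with theta4_double[OF x] theta_nonzero[OF x] theta_nonzero[OF x2] show ?thesis
    by (simp add: logderiv_def divide_simps) algebra
qed

text \<open>Logarithmic differentiation turns the arithmetic mean of the squares into a weighted
  mean of the logarithmic derivatives; the 2 on the left comes from the inner function
  \<open>2 * x\<close>.\<close>

lemma logderiv_theta3_double:
  assumes x: "0 < Re x"
  shows "2 * ((theta3 x)\<^sup>2 + (theta4 x)\<^sup>2) * logderiv theta3 (2 * x) =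
    (theta3 x)\<^sup>2 * logderiv theta3 x + (theta4 x)\<^sup>2 * logderiv theta4 x"
proof -
  have x2: "0 < Re (2 * x)" using x by simp
  have "((\<lambda>x. ((theta3 x)\<^sup>2 + (theta4 x)\<^sup>2) / 2) has_field_derivative
      (theta3 x * deriv theta3 x + theta4 x * deriv theta4 x)) (at x)"
    using DERIV_theta[OF x] by (auto intro!: derivative_eq_intros simp: field_simps)
  then have "4 * theta3 (2 * x) * deriv theta3 (2 * x) = theta3 x * deriv theta3 x + theta4 x * deriv theta4 x"
    using deriv_square_double[OF x DERIV_theta(2)[OF x2] theta3_double] by blast
  moreover have "(theta3 x)\<^sup>2 * logderiv theta3 x = theta3 x * deriv theta3 x"
    "(theta4 x)\<^sup>2 * logderiv theta4 x = theta4 x * deriv theta4 x"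
    using theta_nonzero[OF x] by (simp_all add: logderiv_def power2_eq_square)
  moreover have "(theta3 x)\<^sup>2 + (theta4 x)\<^sup>2 = 2 * (theta3 (2 * x))\<^sup>2"
    by (rule theta_square_double[OF x])
  ultimately show ?thesis using theta_nonzero[OF x2]
    by (simp add: logderiv_def power2_eq_square mult.assoc)
qed

lemma logderiv_theta2_double:
  assumes x: "0 < Re x"
  shows "2 * ((theta3 x)\<^sup>2 - (theta4 x)\<^sup>2) * logderiv theta2 (2 * x) =
    (theta3 x)\<^sup>2 * logderiv theta3 x - (theta4 x)\<^sup>2 * logderiv theta4 x"
proof -
  have x2: "0 < Re (2 * x)" using x by simp
  have "((\<lambda>x. ((theta3 x)\<^sup>2 - (theta4 x)\<^sup>2) / 2) has_field_derivative
      (theta3 x * deriv theta3 x - theta4 x * deriv theta4 x)) (at x)"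
    using DERIV_theta[OF x] by (auto intro!: derivative_eq_intros simp: field_simps)
  then have "4 * theta2 (2 * x) * deriv theta2 (2 * x) = theta3 x * deriv theta3 x - theta4 x * deriv theta4 x"
    using deriv_square_double[OF x DERIV_theta(1)[OF x2] theta2_double] by blast
  moreover have "(theta3 x)\<^sup>2 * logderiv theta3 x = theta3 x * deriv theta3 x"
    "(theta4 x)\<^sup>2 * logderiv theta4 x = theta4 x * deriv theta4 x"
    using theta_nonzero[OF x] by (simp_all add: logderiv_def power2_eq_square)
  moreover have "(theta3 x)\<^sup>2 - (theta4 x)\<^sup>2 = 2 * (theta2 (2 * x))\<^sup>2"
    by (rule theta_square_double[OF x])
  ultimately show ?thesis using theta_nonzero[OF x2]
    by (simp add: logderiv_def power2_eq_square mult.assoc)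
qed

lemma eq_divide_double:
  fixes l :: complex
  assumes "2 * s * l = c" "s \<noteq> 0"
  shows "l = c / (2 * s)"
  using assms by auto

section \<open>Logarithmic derivatives in terms of the nome\<close>

lemma nome_deriv: "(nome has_field_derivative (- (of_real pi * nome x))) (at x)"
  unfolding nome_def[abs_def] by (auto intro!: derivative_eq_intros)

definition theta4_q :: "complex \<Rightarrow> complex" where
  "theta4_q q = 2 * theta_q (q ^ 4) - theta_q q"

text \<open>For \<open>q = nome x\<close> one has \<open>d/dx = - pi q d/dq\<close>. The factor
  \<open>q\<close> is left out, so that the value at \<open>q = 0\<close> is the leading coefficient
  of the logarithmic derivative in \<open>x\<close>.\<close>

definition log_theta_q :: "(complex \<Rightarrow> complex) \<Rightarrow> complex \<Rightarrow> complex" where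
  "log_theta_q f q = - of_real pi * (deriv f q / f q)"

lemma logderiv_nome:
  assumes f: "f holomorphic_on ball 0 1" and eq: "\<And>x. 0 < Re x \<Longrightarrow> t x = f (nome x)"
    and x: "0 < Re x"
  shows "logderiv t x = nome x * log_theta_q f (nome x)"
proof -
  have "(f has_field_derivative deriv f (nome x)) (at (nome x))"
    using holomorphic_derivI[OF f] norm_nome_less_1[OF x] by auto
  from DERIV_chain2[OF this nome_deriv]
  have "((\<lambda>x. f (nome x)) has_field_derivative deriv f (nome x) * (- (of_real pi * nome x))) (at x)" .
  then have "(t has_field_derivative deriv f (nome x) * (- (of_real pi * nome x))) (at x)"
    by (rule has_field_derivative_transform_within_open[where S = rhp]) (use x eq in auto)
  then show ?thesis by (simp add: logderiv_def DERIV_imp_deriv eq[OF x] log_theta_q_def)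
qed

lemma theta4_conv_theta4_q: "0 < Re x \<Longrightarrow> theta4 x = theta4_q (nome x)"
  by (simp add: theta4_def theta4_q_def theta3_conv_theta_q nome_mult_numeral)

lemma theta4_q_holomorphic: "theta4_q holomorphic_on ball 0 1"
proof -
  have "(theta_q \<circ> (\<lambda>q. q ^ 4)) holomorphic_on ball 0 1"
    by (rule holomorphic_on_compose_gen[OF _ theta_q_holomorphic])
       (auto intro!: holomorphic_intros simp: norm_power power_less_one_iff)
  then show ?thesis
    unfolding theta4_q_def[abs_def] o_def by (intro holomorphic_intros theta_q_holomorphic)
qed

lemma nome_surj:
  assumes "q \<noteq> 0" "norm q < 1"
  obtains x where "0 < Re x" "nome x = q"
proof
  show "nome (- (Ln q / of_real pi)) = q"
    using assms by (simp add: nome_def)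
  show "0 < Re (- (Ln q / of_real pi))"
    using assms by (simp add: divide_simps)
qed

text \<open>Every point of the punctured disc is a nome, so nonvanishing transfers from the
  half-plane. Together with the value at 0 it makes the logarithmic derivative holomorphic across
  the cusp.\<close>

lemma theta4_q_nonzero:
  assumes "norm q < 1"
  shows "theta4_q q \<noteq> 0"
proof (cases "q = 0")
  case True then show ?thesis by (simp add: theta4_q_def theta_q_0)
next
  case False
  then show ?thesis
    using assms theta4_nonzero by (metis nome_surj theta4_conv_theta4_q)
qed

lemma theta_q_nonzero:
  assumes "norm q < 1"
  shows "theta_q q \<noteq> 0"
proof (cases "q = 0")
  case True then show ?thesis by (simp add: theta_q_0)
next
  case False
  then show ?thesis
    using assms theta3_nonzero by (metis nome_surj theta3_conv_theta_q)
qed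

lemma deriv_theta4_q_0: "deriv theta4_q 0 = - 2"
proof -
  have d: "(theta_q has_field_derivative 2) (at 0)"
    using holomorphic_derivI[OF theta_q_holomorphic, of 0 UNIV] by (simp add: deriv_theta_q_0)
  have "((\<lambda>q::complex. q ^ 4) has_field_derivative 0) (at 0)"
    by (auto intro!: derivative_eq_intros)
  moreover have "(theta_q has_field_derivative 2) (at (0 ^ 4))" using d by simp
  ultimately have "((\<lambda>q. theta_q (q ^ 4)) has_field_derivative 0) (at 0)"
    using DERIV_chain2[where f = theta_q and g = "\<lambda>q. q ^ 4" and x = 0] by fastforce
  from this d have "(theta4_q has_field_derivative - 2) (at 0)"
    unfolding theta4_q_def[abs_def] by (auto intro!: derivative_eq_intros)
  then show ?thesis by (rule DERIV_imp_deriv)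
qed

lemma log_theta_q_holomorphic:
  assumes "f holomorphic_on ball 0 1" "\<And>q. norm q < 1 \<Longrightarrow> f q \<noteq> 0"
  shows "log_theta_q f holomorphic_on ball 0 1"
  unfolding log_theta_q_def[abs_def]
  using assms by (intro holomorphic_intros holomorphic_deriv) auto

lemma holomorphic_nome_tendsto:
  assumes "f holomorphic_on ball 0 1"
  shows "((\<lambda>x. f (nome x)) \<longlongrightarrow> f 0) at_right_infinity"
proof -
  have "isCont f 0"
    using assms holomorphic_on_imp_continuous_on continuous_on_eq_continuous_at open_ball
    by (metis mem_ball_0 norm_zero zero_less_one)
  then have "(f \<longlongrightarrow> f 0) (nhds 0)"
    using tendsto_at_iff_tendsto_nhds[of f 0] by (simp add: isCont_def)
  then show ?thesis by (rule filterlim_compose[OF _ nome_tendsto_0])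
qed

text \<open>The fourth power removes the fractional power of the nome; 16 is the fourth power of the
  leading coefficient 2.\<close>

lemma theta2_pow4_tendsto: "((\<lambda>x. theta2 x ^ 4 / nome x) \<longlongrightarrow> 16) at_right_infinity"
proof -
  have "filterlim (\<lambda>r::real. r / 4) at_top at_top" by real_asymp
  then have "filterlim (\<lambda>x. Re x / 4) at_top at_right_infinity"
    by (rule filterlim_compose[OF _ filterlim_filtercomap])
  then have "filterlim (\<lambda>x. x / 4) at_right_infinity at_right_infinity"
    by (simp add: filterlim_filtercomap_iff o_def)
  from filterlim_compose[OF theta2_quotient_tendsto this]
  have "((\<lambda>x. (theta2 x / nome (x / 4)) ^ 4) \<longlongrightarrow> 2 ^ 4) at_right_infinity"
    by (intro tendsto_intros) simp
  moreover have "nome (x / 4) ^ 4 = nome x" for x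
    using nome_mult_numeral[of "num.Bit0 (num.Bit0 num.One)" "x / 4"] by simp
  ultimately show ?thesis by (simp add: power_divide)
qed

text \<open>With \<open>q = nome x\<close> the two logarithmic derivatives begin with
  \<open>- 2 pi q\<close> and \<open>2 pi q\<close>, and \<open>theta2 x ^ 4\<close> with
  \<open>16 q\<close>.\<close>

lemma logderiv_theta3_minus_theta4_tendsto:
  "((\<lambda>x. (logderiv theta3 x - logderiv theta4 x) / theta2 x ^ 4) \<longlongrightarrow> - of_real pi / 4) at_right_infinity"
proof (rule Lim_transform_eventually)
  have "((\<lambda>x. (log_theta_q theta_q (nome x) - log_theta_q theta4_q (nome x)) / (theta2 x ^ 4 / nome x))
      \<longlongrightarrow> (log_theta_q theta_q 0 - log_theta_q theta4_q 0) / 16) at_right_infinity"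
    by (intro tendsto_intros theta2_pow4_tendsto holomorphic_nome_tendsto log_theta_q_holomorphic
        theta_q_holomorphic theta4_q_holomorphic theta_q_nonzero theta4_q_nonzero) simp_all
  also have "(log_theta_q theta_q 0 - log_theta_q theta4_q 0) / 16 = - of_real pi / 4"
    by (simp add: log_theta_q_def deriv_theta_q_0 deriv_theta4_q_0 theta4_q_def theta_q_0)
  finally show "((\<lambda>x. (log_theta_q theta_q (nome x) - log_theta_q theta4_q (nome x)) / (theta2 x ^ 4 / nome x))
      \<longlongrightarrow> - of_real pi / 4) at_right_infinity" .
  show "\<forall>\<^sub>F x in at_right_infinity. (log_theta_q theta_q (nome x) - log_theta_q theta4_q (nome x)) / (theta2 x ^ 4 / nome x)
      = (logderiv theta3 x - logderiv theta4 x) / theta2 x ^ 4"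
    using eventually_Re_pos
    by eventually_elim
       (simp add: logderiv_nome[OF theta_q_holomorphic theta3_conv_theta_q]
         logderiv_nome[OF theta4_q_holomorphic theta4_conv_theta4_q] algebra_simps diff_divide_distrib)
qed

text \<open>The quotient of both sides is invariant under \<open>x \<mapsto> 2 x\<close>, hence equal to its limit at infinity.\<close>

lemma logderiv_theta3_minus_theta4:
  assumes x: "0 < Re x"
  shows "logderiv theta3 x - logderiv theta4 x = - (of_real pi / 4) * theta2 x ^ 4"
proof -
  define R where "R x = (logderiv theta3 x - logderiv theta4 x) / theta2 x ^ 4" for x
  have step: "R (2 * x) = R x" if x: "0 < Re x" for x
  proof -
    have x2: "0 < Re (2 * x)" using x by simp
    define a b u v where "a = (theta3 x)\<^sup>2" and "b = (theta4 x)\<^sup>2"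
      and "u = logderiv theta3 x" and "v = logderiv theta4 x"
    have p: "a + b = 2 * (theta3 (2 * x))\<^sup>2" "a - b = 2 * (theta2 (2 * x))\<^sup>2"
      using theta_square_double[OF x] by (simp_all add: a_def b_def)
    then have nz: "a + b \<noteq> 0" "a - b \<noteq> 0" using theta_nonzero[OF x2] by auto
    have t: "theta2 (2 * x) ^ 4 = (a - b)\<^sup>2 / 4" "theta2 x ^ 4 = (a - b) * (a + b)"
      using p jacobi_quartic[OF x] unfolding a_def b_def by (simp_all add: field_simps) algebra+
    have "2 * (a + b) * logderiv theta3 (2 * x) = a * u + b * v"
      using logderiv_theta3_double[OF x] by (simp add: a_def b_def u_def v_def)
    then have l3: "logderiv theta3 (2 * x) = (a * u + b * v) / (2 * (a + b))"
      using nz(1) by (rule eq_divide_double)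
    have l4: "logderiv theta4 (2 * x) = (u + v) / 4"
      using logderiv_theta4_double[OF x] by (simp add: u_def v_def)
    \<comment> \<open>Doubling multiplies this difference by \<open>(a - b) / (4 * (a + b))\<close>,
      and by the two equations \<open>t\<close> it multiplies \<open>theta2 ^ 4\<close> by the same
      factor.\<close>
    have "logderiv theta3 (2 * x) - logderiv theta4 (2 * x) = (u - v) * (a - b) / (4 * (a + b))"
    proof -
      have "((s - b) * u + b * v) / (2 * s) - (u + v) / 4 = (u - v) * (s - b - b) / (4 * s)" if "s \<noteq> 0" for s
        using that by (simp add: field_simps)
      from this[OF nz(1)] show ?thesis unfolding l3 l4 by simp
    qed
    then have "R (2 * x) = (u - v) / ((a - b) * (a + b))"
    proof -
      have "w * d / (4 * s) / (d\<^sup>2 / 4) = w / (d * s)" if "s \<noteq> 0" "d \<noteq> 0" for w s d :: complex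
        using that by (simp add: power2_eq_square)
      then show ?thesis
        unfolding R_def t using nz \<open>logderiv theta3 (2 * x) - logderiv theta4 (2 * x) = _\<close> by metis
    qed
    then show ?thesis by (simp add: R_def t u_def v_def)
  qed
  have "R (2 ^ n * x) = R x" for n
  proof (induction n)
    case (Suc n)
    then show ?case using step[OF Re_pow2_mult[OF x, of n]] by (simp add: mult.assoc)
  qed simp
  moreover have "((\<lambda>n. R (2 ^ n * x)) \<longlongrightarrow> - of_real pi / 4) sequentially"
    unfolding R_def
    by (rule filterlim_compose[OF logderiv_theta3_minus_theta4_tendsto filterlim_pow2_mult[OF x]])
  ultimately have "R x = - of_real pi / 4" by (simp add: LIMSEQ_const_iff)
  then show ?thesis using theta_nonzero[OF x] by (simp add: R_def divide_simps)
qed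

text \<open>At \<open>2 * y\<close> both terms are expressed through \<open>theta3\<close> and
  \<open>theta4\<close> at \<open>y\<close>, so the difference reduces to the known one at
  \<open>y\<close>, without another passage to the limit.\<close>

lemma logderiv_theta2_minus_theta4:
  assumes "0 < Re x"
  shows "logderiv theta2 x - logderiv theta4 x = - (of_real pi / 4) * theta3 x ^ 4"
proof -
  define y where "y = x / 2"
  have y: "0 < Re y" and y2: "0 < Re (2 * y)" and x: "x = 2 * y" using assms by (simp_all add: y_def)
  define a b u v where "a = (theta3 y)\<^sup>2" and "b = (theta4 y)\<^sup>2"
    and "u = logderiv theta3 y" and "v = logderiv theta4 y"
  have p: "a + b = 2 * (theta3 (2 * y))\<^sup>2" "a - b = 2 * (theta2 (2 * y))\<^sup>2"
    using theta_square_double[OF y] by (simp_all add: a_def b_def)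
  then have nz: "a + b \<noteq> 0" "a - b \<noteq> 0" using theta_nonzero[OF y2] by auto
  have t: "theta3 (2 * y) ^ 4 = (a + b)\<^sup>2 / 4" "theta2 y ^ 4 = (a - b) * (a + b)"
    using p jacobi_quartic[OF y] unfolding a_def b_def by (simp_all add: field_simps) algebra+
  have "2 * (a - b) * logderiv theta2 (2 * y) = a * u - b * v"
    using logderiv_theta2_double[OF y] by (simp add: a_def b_def u_def v_def)
  then have l2: "logderiv theta2 (2 * y) = (a * u - b * v) / (2 * (a - b))"
    using nz(2) by (rule eq_divide_double)
  have l4: "logderiv theta4 (2 * y) = (u + v) / 4"
    using logderiv_theta4_double[OF y] by (simp add: u_def v_def)
  have uv: "u - v = - (of_real pi / 4) * ((a - b) * (a + b))"
    using logderiv_theta3_minus_theta4[OF y] by (simp add: u_def v_def t)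
  have "logderiv theta2 (2 * y) - logderiv theta4 (2 * y) = (u - v) * (a + b) / (4 * (a - b))"
    unfolding l2 l4 using nz(2) by (simp add: field_simps)
  also have "\<dots> = - (of_real pi / 4) * ((a + b)\<^sup>2 / 4)"
  proof -
    have "c * (d * s) * s / (4 * d) = c * (s\<^sup>2 / 4)" if "d \<noteq> 0" for c d s :: complex
      using that by (simp add: power2_eq_square)
    then show ?thesis unfolding uv using nz(2) by blast
  qed
  finally show ?thesis by (simp add: x t)
qed

lemma logderiv_theta2_minus_theta3:
  assumes "0 < Re x"
  shows "logderiv theta2 x - logderiv theta3 x = - (of_real pi / 4) * theta4 x ^ 4"
proof -
  have "logderiv theta2 x - logderiv theta3 x =
      (logderiv theta2 x - logderiv theta4 x) - (logderiv theta3 x - logderiv theta4 x)"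
    by simp
  also have "\<dots> = - (of_real pi / 4) * (theta3 x ^ 4 - theta2 x ^ 4)"
    unfolding logderiv_theta2_minus_theta4[OF assms] logderiv_theta3_minus_theta4[OF assms]
    by (simp only: right_diff_distrib)
  finally show ?thesis by (simp add: jacobi_quartic[OF assms])
qed

lemma logderiv_holomorphic:
  "logderiv theta2 holomorphic_on rhp" "logderiv theta3 holomorphic_on rhp" "logderiv theta4 holomorphic_on rhp"
  unfolding logderiv_def[abs_def]
  by (auto intro!: holomorphic_intros theta2_holomorphic theta3_holomorphic theta4_holomorphic
      simp: theta_nonzero)

lemma DERIV_logderiv:
  assumes "0 < Re x"
  shows "(logderiv theta3 has_field_derivative deriv (logderiv theta3) x) (at x)"
    and "(logderiv theta4 has_field_derivative deriv (logderiv theta4) x) (at x)"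
  using holomorphic_derivI[OF logderiv_holomorphic(2) open_rhp]
    holomorphic_derivI[OF logderiv_holomorphic(3) open_rhp] assms by auto

lemma deriv_logderiv_double:
  assumes x: "0 < Re x"
  shows "8 * deriv (logderiv theta4) (2 * x) = deriv (logderiv theta3) x + deriv (logderiv theta4) x"
proof -
  have x2: "0 < Re (2 * x)" using x by simp
  have "((\<lambda>y. 2 * y) has_field_derivative 2) (at x)"
    by (auto intro!: derivative_eq_intros)
  from DERIV_chain2[OF DERIV_logderiv(2)[OF x2] this]
  have "((\<lambda>y. 4 * logderiv theta4 (2 * y)) has_field_derivative 8 * deriv (logderiv theta4) (2 * x)) (at x)"
    by (auto intro!: derivative_eq_intros)
  then have "((\<lambda>y. logderiv theta3 y + logderiv theta4 y) has_field_derivative 8 * deriv (logderiv theta4) (2 * x)) (at x)"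
  proof (rule has_field_derivative_transform_within_open[where S = rhp])
    show "4 * logderiv theta4 (2 * y) = logderiv theta3 y + logderiv theta4 y" if "y \<in> rhp" for y
      using that by (simp add: logderiv_theta4_double[of y])
  qed (use x in auto)
  then show ?thesis
    using DERIV_add[OF DERIV_logderiv[OF x]] by (rule DERIV_unique)
qed

lemma DERIV_theta_pow4:
  assumes "0 < Re x"
  shows "((\<lambda>x. theta2 x ^ 4) has_field_derivative 4 * logderiv theta2 x * theta2 x ^ 4) (at x)"
    and "((\<lambda>x. theta4 x ^ 4) has_field_derivative 4 * logderiv theta4 x * theta4 x ^ 4) (at x)"
  using DERIV_theta[OF assms] theta_nonzero[OF assms]
  by (auto intro!: derivative_eq_intros simp: logderiv_def power4_eq_xxxx power3_eq_cube)

text \<open>The difference of the logarithmic derivatives is a constant multiple of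
  \<open>theta2 ^ 4\<close>, and the logarithmic derivative of \<open>theta2 ^ 4\<close> is
  \<open>4 * logderiv theta2\<close>.\<close>

lemma deriv_logderiv_diff:
  assumes x: "0 < Re x"
  shows "deriv (logderiv theta3) x - deriv (logderiv theta4) x =
    4 * logderiv theta2 x * (logderiv theta3 x - logderiv theta4 x)"
proof -
  have "((\<lambda>x. - (of_real pi / 4) * theta2 x ^ 4) has_field_derivative
      - (of_real pi / 4) * (4 * logderiv theta2 x * theta2 x ^ 4)) (at x)"
    by (rule DERIV_cmult[OF DERIV_theta_pow4(1)[OF x]])
  then have "((\<lambda>x. logderiv theta3 x - logderiv theta4 x) has_field_derivative
      - (of_real pi / 4) * (4 * logderiv theta2 x * theta2 x ^ 4)) (at x)"
    by (rule has_field_derivative_transform_within_open[where S = rhp])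
       (use x in \<open>auto simp: logderiv_theta3_minus_theta4\<close>)
  with DERIV_diff[OF DERIV_logderiv[OF x]]
  have "deriv (logderiv theta3) x - deriv (logderiv theta4) x = - (of_real pi / 4) * (4 * logderiv theta2 x * theta2 x ^ 4)"
    by (rule DERIV_unique)
  also have "\<dots> = 4 * logderiv theta2 x * (logderiv theta3 x - logderiv theta4 x)"
    by (simp add: logderiv_theta3_minus_theta4[OF x])
  finally show ?thesis .
qed

lemma deriv_logderiv_theta4_nome:
  assumes x: "0 < Re x"
  shows "deriv (logderiv theta4) x = nome x *
    (- of_real pi * (log_theta_q theta4_q (nome x) + nome x * deriv (log_theta_q theta4_q) (nome x)))"
proof -
  let ?h = "log_theta_q theta4_q"
  have "(?h has_field_derivative deriv ?h (nome x)) (at (nome x))"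
    using holomorphic_derivI[OF log_theta_q_holomorphic[OF theta4_q_holomorphic theta4_q_nonzero]]
      norm_nome_less_1[OF x] by auto
  from DERIV_mult[OF nome_deriv DERIV_chain2[OF this nome_deriv]]
  have "((\<lambda>x. nome x * ?h (nome x)) has_field_derivative
      nome x * (- of_real pi * (?h (nome x) + nome x * deriv ?h (nome x)))) (at x)"
    by (simp add: algebra_simps)
  then have "(logderiv theta4 has_field_derivative
      nome x * (- of_real pi * (?h (nome x) + nome x * deriv ?h (nome x)))) (at x)"
    by (rule has_field_derivative_transform_within_open[where S = rhp])
       (use x in \<open>auto simp: logderiv_nome[OF theta4_q_holomorphic theta4_conv_theta4_q]\<close>)
  then show ?thesis by (rule DERIV_imp_deriv)
qed

text \<open>Its vanishing is the Riccati equation for \<open>logderiv theta4\<close>. The function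
  \<open>theta4\<close> is the convenient one to start with, because its logarithmic derivative
  doubles linearly with constant coefficients.\<close>

definition riccati_defect :: "complex \<Rightarrow> complex" where
  "riccati_defect x = deriv (logderiv theta4) x - 2 * (logderiv theta4 x)\<^sup>2
     + (of_real pi)\<^sup>2 / 8 * (theta2 x ^ 4 * theta3 x ^ 4)"

text \<open>Each of the three terms carries a factor \<open>nome x\<close>. Only this order of
  vanishing matters later, so the limit is not named.\<close>

lemma riccati_defect_tendsto: "\<exists>c. ((\<lambda>x. riccati_defect x / nome x) \<longlongrightarrow> c) at_right_infinity"
proof -
  let ?h = "log_theta_q theta4_q"
  let ?F = "\<lambda>x. (- of_real pi * (?h (nome x) + nome x * deriv ?h (nome x))) - 2 * nome x * (?h (nome x))\<^sup>2
    + (of_real pi)\<^sup>2 / 8 * (theta2 x ^ 4 / nome x) * theta3 x ^ 4"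
  have h: "?h holomorphic_on ball 0 1"
    by (rule log_theta_q_holomorphic[OF theta4_q_holomorphic theta4_q_nonzero])
  have "(?F \<longlongrightarrow> (- of_real pi * (?h 0 + 0 * deriv ?h 0)) - 2 * 0 * (?h 0)\<^sup>2 + (of_real pi)\<^sup>2 / 8 * 16 * 1 ^ 4)
      at_right_infinity"
    by (intro tendsto_intros theta2_pow4_tendsto theta3_tendsto nome_tendsto_0 holomorphic_nome_tendsto
        holomorphic_deriv h open_ball)
  moreover have "\<forall>\<^sub>F x in at_right_infinity. ?F x = riccati_defect x / nome x"
    using eventually_Re_pos
    by eventually_elim
       (simp add: riccati_defect_def deriv_logderiv_theta4_nome power2_eq_square
         logderiv_nome[OF theta4_q_holomorphic theta4_conv_theta4_q] add_divide_distrib diff_divide_distrib)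
  ultimately show ?thesis by (blast intro: Lim_transform_eventually)
qed

text \<open>The fourth powers are differences of logarithmic derivatives up to the factor
  \<open>- p\<close>. Eliminating them leaves a polynomial identity in \<open>u\<close>,
  \<open>v\<close>, \<open>w\<close> and the derivatives of \<open>u\<close> and
  \<open>v\<close>.\<close>

lemma riccati_defect_double:
  assumes x: "0 < Re x"
  shows "riccati_defect (2 * x) = riccati_defect x / 4"
proof -
  define u v w where "u = logderiv theta3 x" and "v = logderiv theta4 x" and "w = logderiv theta2 x"
  define p :: complex where "p = of_real pi / 4"
  have uv: "u - v = - p * theta2 x ^ 4" and wv: "w - v = - p * theta3 x ^ 4"
    using logderiv_theta3_minus_theta4[OF x] logderiv_theta2_minus_theta4[OF x]
    by (simp_all add: u_def v_def w_def p_def)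
  have "(theta2 x) ^ 4 = 4 * (theta3 (2 * x))\<^sup>2 * (theta2 (2 * x))\<^sup>2"
    using theta2_half[OF x] by algebra
  then have "16 * (theta2 (2 * x) ^ 4 * theta3 (2 * x) ^ 4) = theta2 x ^ 4 * theta2 x ^ 4"
    by algebra
  then have 1: "16 * (p\<^sup>2 * (theta2 (2 * x) ^ 4 * theta3 (2 * x) ^ 4)) = (u - v)\<^sup>2"
    unfolding uv by algebra
  have pp: "(of_real pi)\<^sup>2 / 8 = 2 * p\<^sup>2" by (simp add: p_def power2_eq_square)
  have 2: "8 * riccati_defect (2 * x) = deriv (logderiv theta3) x + deriv (logderiv theta4) x - (u + v)\<^sup>2 + (u - v)\<^sup>2"
    using deriv_logderiv_double[OF x] 1 unfolding riccati_defect_def pp logderiv_theta4_double[OF x] u_def[symmetric] v_def[symmetric]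
    by (simp add: power_divide algebra_simps)
  have 3: "riccati_defect x = deriv (logderiv theta4) x - 2 * v\<^sup>2 + 2 * (w - v) * (u - v)"
    unfolding riccati_defect_def pp uv wv v_def[symmetric] by algebra
  have 4: "deriv (logderiv theta3) x - deriv (logderiv theta4) x = 4 * w * (u - v)"
    using deriv_logderiv_diff[OF x] by (simp add: u_def v_def w_def)
  have "8 * riccati_defect (2 * x) = 2 * riccati_defect x"
    using 2 3 4 by algebra
  then show ?thesis by (simp add: eq_divide_eq mult.commute)
qed

text \<open>\<open>4 ^ n * riccati_defect (2 ^ n * x)\<close> does not depend on \<open>n\<close>,
  while the defect is of the order of \<open>nome (2 ^ n * x)\<close>, which decays doubly
  exponentially and beats \<open>4 ^ n\<close>.\<close>

lemma riccati_defect_eq_0: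
  assumes x: "0 < Re x"
  shows "riccati_defect x = 0"
proof -
  obtain c where c: "((\<lambda>x. riccati_defect x / nome x) \<longlongrightarrow> c) at_right_infinity"
    using riccati_defect_tendsto by blast
  have eq: "4 ^ n * riccati_defect (2 ^ n * x) = riccati_defect x" for n
  proof (induction n)
    case (Suc n)
    have "4 ^ Suc n * riccati_defect (2 ^ Suc n * x) = 4 ^ n * (4 * riccati_defect (2 * (2 ^ n * x)))"
      by (simp add: mult.assoc)
    also have "\<dots> = riccati_defect x"
      unfolding riccati_defect_double[OF Re_pow2_mult[OF x]] using Suc by simp
    finally show ?case .
  qed simp
  have "((\<lambda>n. 4 ^ n * nome (2 ^ n * x)) \<longlongrightarrow> 0) sequentially"
  proof (rule tendsto_norm_zero_cancel)
    have "((\<lambda>n. 4 ^ n * exp (- (pi * (2 ^ n * Re x)))) \<longlongrightarrow> 0) sequentially"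
      using x by real_asymp
    then show "((\<lambda>n. norm (4 ^ n * nome (2 ^ n * x))) \<longlongrightarrow> 0) sequentially"
      by (simp add: norm_mult norm_power norm_nome Re_pow2)
  qed
  from tendsto_mult[OF this filterlim_compose[OF c filterlim_pow2_mult[OF x]]]
  have "((\<lambda>n. 4 ^ n * riccati_defect (2 ^ n * x)) \<longlongrightarrow> 0) sequentially"
    by simp
  then show ?thesis by (simp add: eq LIMSEQ_const_iff)
qed

text \<open>In Halphen's form the equation for \<open>theta4\<close> reads
  \<open>v' = 2 (v u + v w - u w)\<close>. Adding \<open>deriv_logderiv_diff\<close> exchanges the
  roles of \<open>u\<close> and \<open>v\<close>.\<close>

lemma deriv_logderiv_theta3:
  assumes x: "0 < Re x"
  shows "deriv (logderiv theta3) x = 2 * (logderiv theta3 x)\<^sup>2 + (of_real pi)\<^sup>2 / 8 * (theta2 x ^ 4 * theta4 x ^ 4)"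
proof -
  define u v w where "u = logderiv theta3 x" and "v = logderiv theta4 x" and "w = logderiv theta2 x"
  define p :: complex where "p = of_real pi / 4"
  have uv: "u - v = - p * theta2 x ^ 4" and wv: "w - v = - p * theta3 x ^ 4" and wu: "w - u = - p * theta4 x ^ 4"
    using logderiv_theta3_minus_theta4[OF x] logderiv_theta2_minus_theta4[OF x] logderiv_theta2_minus_theta3[OF x]
    by (simp_all add: u_def v_def w_def p_def)
  have pp: "(of_real pi)\<^sup>2 / 8 = 2 * p\<^sup>2" by (simp add: p_def power2_eq_square)
  have "deriv (logderiv theta4) x = 2 * v\<^sup>2 - 2 * (w - v) * (u - v)"
    using riccati_defect_eq_0[OF x] unfolding riccati_defect_def pp uv wv v_def[symmetric] by algebra
  moreover have "deriv (logderiv theta3) x - deriv (logderiv theta4) x = 4 * w * (u - v)"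
    using deriv_logderiv_diff[OF x] by (simp add: u_def v_def w_def)
  ultimately have "deriv (logderiv theta3) x = 2 * u\<^sup>2 + 2 * ((u - v) * (w - u))"
    by algebra
  also have "(u - v) * (w - u) = p\<^sup>2 * (theta2 x ^ 4 * theta4 x ^ 4)"
    unfolding uv wu by algebra
  finally show ?thesis by (simp add: pp u_def)
qed

section \<open>The functional equation\<close>

definition rtheta2 :: "real \<Rightarrow> real" where "rtheta2 r = Re (theta2 (of_real r))"
definition rtheta3 :: "real \<Rightarrow> real" where "rtheta3 r = Re (theta3 (of_real r))"
definition rtheta4 :: "real \<Rightarrow> real" where "rtheta4 r = Re (theta4 (of_real r))"

lemma rtheta3_has_sum_aux:
  assumes "0 < r"
  shows "theta3 (of_real r) = of_real (rtheta3 r) \<and>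
    ((\<lambda>m::int. exp (- (pi * r)) ^ nat (m\<^sup>2)) has_sum rtheta3 r) UNIV"
proof -
  let ?f = "\<lambda>m::int. exp (- (pi * r)) ^ nat (m\<^sup>2)"
  have S: "(?f has_sum infsum ?f UNIV) UNIV"
    using summable_int_squares[of "exp (- (pi * r))"] assms by simp
  have n: "nome (of_real r) = of_real (exp (- (pi * r)))"
    by (simp add: nome_def exp_of_real[symmetric])
  have x: "0 < Re (of_real r)" using assms by simp
  have "((\<lambda>m. complex_of_real (?f m)) has_sum of_real (infsum ?f UNIV)) UNIV"
    by (rule has_sum_of_real[OF S])
  moreover have "((\<lambda>m. complex_of_real (?f m)) has_sum theta3 (of_real r)) UNIV"
    using theta_q_sums_has_sum(2)[OF norm_nome_less_1[OF x]] theta3_conv_theta_q[OF x] by (simp add: n)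
  ultimately have e: "theta3 (of_real r) = of_real (infsum ?f UNIV)"
    by (rule has_sum_unique[rotated])
  then have "rtheta3 r = infsum ?f UNIV" by (simp add: rtheta3_def)
  with S e show ?thesis by simp
qed

lemmas theta3_of_real = rtheta3_has_sum_aux[THEN conjunct1]
lemmas rtheta3_has_sum = rtheta3_has_sum_aux[THEN conjunct2]

lemma theta2_of_real: "0 < r \<Longrightarrow> theta2 (of_real r) = of_real (rtheta2 r)"
  using theta3_of_real[of r] theta3_of_real[of "r / 4"] by (simp add: rtheta2_def theta2_def)

lemma theta4_of_real: "0 < r \<Longrightarrow> theta4 (of_real r) = of_real (rtheta4 r)"
  using theta3_of_real[of r] theta3_of_real[of "4 * r"] by (simp add: rtheta4_def theta4_def)

lemma of_real_eq_transfer: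
  "complex_of_real a = of_real b \<Longrightarrow> a = b"
  by simp

lemma rtheta_identities:
  assumes r: "0 < r"
  shows "(rtheta3 (2 * r))\<^sup>2 = ((rtheta3 r)\<^sup>2 + (rtheta4 r)\<^sup>2) / 2"
    and "(rtheta4 (2 * r))\<^sup>2 = rtheta3 r * rtheta4 r"
    and "(rtheta3 r)\<^sup>2 - (rtheta4 r)\<^sup>2 = 2 * (rtheta2 (2 * r))\<^sup>2"
    and "(rtheta2 r)\<^sup>2 = 2 * rtheta3 (2 * r) * rtheta2 (2 * r)"
    and "rtheta3 r ^ 4 = rtheta2 r ^ 4 + rtheta4 r ^ 4"
    and "(rtheta3 r)\<^sup>2 = (rtheta3 (2 * r))\<^sup>2 + (rtheta2 (2 * r))\<^sup>2"
proof -
  have x: "0 < Re (of_real r)" and r2: "0 < 2 * r" using r by simp_all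
  note t = theta2_of_real[OF r] theta3_of_real[OF r] theta4_of_real[OF r]
    theta2_of_real[OF r2, simplified] theta3_of_real[OF r2, simplified] theta4_of_real[OF r2, simplified]
  show 1: "(rtheta3 (2 * r))\<^sup>2 = ((rtheta3 r)\<^sup>2 + (rtheta4 r)\<^sup>2) / 2"
    by (rule of_real_eq_transfer) (use theta3_double[OF x] in \<open>simp add: t\<close>)
  show "(rtheta4 (2 * r))\<^sup>2 = rtheta3 r * rtheta4 r"
    by (rule of_real_eq_transfer) (use theta4_double[OF x] in \<open>simp add: t\<close>)
  show 2: "(rtheta3 r)\<^sup>2 - (rtheta4 r)\<^sup>2 = 2 * (rtheta2 (2 * r))\<^sup>2"
    by (rule of_real_eq_transfer) (use theta_square_double(2)[OF x] in \<open>simp add: t\<close>)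
  show "(rtheta2 r)\<^sup>2 = 2 * rtheta3 (2 * r) * rtheta2 (2 * r)"
    by (rule of_real_eq_transfer) (use theta2_half[OF x] in \<open>simp add: t\<close>)
  show "rtheta3 r ^ 4 = rtheta2 r ^ 4 + rtheta4 r ^ 4"
    by (rule of_real_eq_transfer) (use jacobi_quartic[OF x] in \<open>simp add: t\<close>)
  show "(rtheta3 r)\<^sup>2 = (rtheta3 (2 * r))\<^sup>2 + (rtheta2 (2 * r))\<^sup>2"
    using 1 2 by (simp add: field_simps)
qed

lemma rtheta3_pos:
  assumes "0 < r"
  shows "0 < rtheta3 r"
proof -
  have "0 \<le> rtheta3 r"
    by (rule has_sum_nonneg[OF rtheta3_has_sum[OF assms]]) simp
  moreover have "theta3 (of_real r) \<noteq> 0" using theta3_nonzero assms by simp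
  ultimately show ?thesis using theta3_of_real[OF assms] by (metis of_real_0 order_le_less)
qed

lemma rtheta2_pos:
  assumes "0 < r"
  shows "0 < rtheta2 r"
proof -
  have r4: "0 < r / 4" using assms by simp
  have "rtheta3 r \<le> rtheta3 (r / 4)"
    by (rule has_sum_mono[OF rtheta3_has_sum[OF assms] rtheta3_has_sum[OF r4]])
       (use assms in \<open>auto intro!: power_mono\<close>)
  moreover have "rtheta2 r = rtheta3 (r / 4) - rtheta3 r"
    by (simp add: rtheta2_def theta2_def rtheta3_def)
  moreover have "theta2 (of_real r) \<noteq> 0" using theta2_nonzero assms by simp
  ultimately show ?thesis using theta2_of_real[OF assms]
    by (metis diff_ge_0_iff_ge of_real_0 order_le_less)
qed

text \<open>The alternating series shows no sign directly; the sign is read off from the square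
  \<open>rtheta4 (2 * r) ^ 2 = rtheta3 r * rtheta4 r\<close>.\<close>

lemma rtheta4_pos:
  assumes "0 < r"
  shows "0 < rtheta4 r"
proof -
  have "theta4 (of_real r) \<noteq> 0" using theta4_nonzero assms by simp
  then have "rtheta4 r \<noteq> 0" using theta4_of_real[OF assms] by auto
  moreover have "0 \<le> rtheta4 r"
    using rtheta_identities(2)[OF assms] rtheta3_pos[OF assms] zero_le_power2 zero_le_mult_iff
    by (metis linorder_not_less)
  ultimately show ?thesis by simp
qed

section \<open>Arithmetic-geometric mean sequences\<close>

definition agm_seq :: "(nat \<Rightarrow> real) \<Rightarrow> (nat \<Rightarrow> real) \<Rightarrow> bool" where
  "agm_seq a b \<longleftrightarrow> (\<forall>n. 0 < a n \<and> 0 < b n \<and> a (Suc n) = (a n + b n) / 2 \<and> (b (Suc n))\<^sup>2 = a n * b n)"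

lemma agm_seqD:
  assumes "agm_seq a b"
  shows "0 < a n" "0 < b n" "a (Suc n) = (a n + b n) / 2" "(b (Suc n))\<^sup>2 = a n * b n"
  using assms unfolding agm_seq_def by blast+

text \<open>Both means are monotone and homogeneous, so domination by the factor \<open>t\<close> at
  step \<open>k\<close> persists and passes to the common limit:
  \<open>t * l \<le> l\<close>.\<close>

lemma agm_seq_scale_le:
  assumes ab: "agm_seq a b" and cd: "agm_seq c d" and lim: "a \<longlonglongrightarrow> l" "c \<longlonglongrightarrow> l" "0 < l"
    and t: "0 < t" "t * a k \<le> c k" "t * b k \<le> d k"
  shows "t \<le> 1"
proof -
  have *: "t * a (n + k) \<le> c (n + k) \<and> t * b (n + k) \<le> d (n + k)" for n
  proof (induction n)
    case (Suc n)
    have "(t * b (Suc (n + k)))\<^sup>2 = (t * a (n + k)) * (t * b (n + k))"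
      by (simp only: power_mult_distrib agm_seqD(4)[OF ab]) (simp add: power2_eq_square)
    also have "\<dots> \<le> c (n + k) * d (n + k)"
      using Suc agm_seqD(1,2)[OF ab] agm_seqD(1,2)[OF cd] t(1)
      by (intro mult_mono) (auto simp: less_imp_le)
    also have "\<dots> = (d (Suc (n + k)))\<^sup>2"
      by (simp add: agm_seqD(4)[OF cd])
    finally have "t * b (Suc (n + k)) \<le> d (Suc (n + k))"
      by (rule power2_le_imp_le) (use agm_seqD(2)[OF cd] in \<open>simp add: less_imp_le\<close>)
    moreover have "t * a (Suc (n + k)) \<le> c (Suc (n + k))"
      using Suc by (simp add: agm_seqD(3)[OF ab] agm_seqD(3)[OF cd] algebra_simps)
    ultimately show ?case by simp
  qed (use t in auto)
  have "t * l \<le> l"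
  proof (rule LIMSEQ_le)
    show "(\<lambda>n. t * a (n + k)) \<longlonglongrightarrow> t * l"
      by (intro tendsto_intros LIMSEQ_ignore_initial_segment lim)
    show "(\<lambda>n. c (n + k)) \<longlonglongrightarrow> l"
      by (intro LIMSEQ_ignore_initial_segment lim)
  qed (use * in blast)
  with lim(3) show ?thesis by simp
qed

text \<open>If \<open>a 0 \<le> c 0\<close>, then \<open>b 0 < d 0\<close>, and after one step both
  inequalities are strict. The second pair then dominates a multiple \<open>t > 1\<close> of the
  first, which \<open>agm_seq_scale_le\<close> excludes.\<close>

lemma agm_seq_strict_antimono:
  assumes ab: "agm_seq a b" and cd: "agm_seq c d" and lim: "a \<longlonglongrightarrow> l" "c \<longlonglongrightarrow> l" "0 < l"
    and less: "b 0 * c 0 < d 0 * a 0"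
  shows "c 0 < a 0"
proof (rule ccontr)
  assume "\<not> c 0 < a 0"
  then have ac: "a 0 \<le> c 0" by simp
  note pos = agm_seqD(1,2)[OF ab] agm_seqD(1,2)[OF cd]
  have "b 0 * c 0 < d 0 * c 0"
    using less mult_left_mono[OF ac, of "d 0"] pos by (simp add: less_imp_le order_less_le_trans)
  then have bd: "b 0 < d 0" using pos by simp
  have a1: "a 1 < c 1"
    using ac bd agm_seqD(3)[OF ab, of 0] agm_seqD(3)[OF cd, of 0] by simp
  have "(b 1)\<^sup>2 < (d 1)\<^sup>2"
    using agm_seqD(4)[OF ab, of 0] agm_seqD(4)[OF cd, of 0] mult_le_less_imp_less[OF ac bd] pos
    by (simp add: less_imp_le)
  then have b1: "b 1 < d 1"
    by (rule power2_less_imp_less) (use pos in \<open>simp add: less_imp_le\<close>)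
  define t where "t = min (c 1 / a 1) (d 1 / b 1)"
  have "1 < t" unfolding t_def using a1 b1 pos by simp
  moreover have "t \<le> 1"
  proof (rule agm_seq_scale_le[OF ab cd lim, where k = 1])
    show "0 < t" using \<open>1 < t\<close> by simp
    have "t \<le> c 1 / a 1" "t \<le> d 1 / b 1" by (simp_all add: t_def)
    then show "t * a 1 \<le> c 1" "t * b 1 \<le> d 1"
      using pos by (simp_all add: pos_le_divide_eq)
  qed
  ultimately show False by simp
qed

lemma agm_seq_eq:
  assumes ab: "agm_seq a b" and cd: "agm_seq c d" and lim: "a \<longlonglongrightarrow> l" "c \<longlonglongrightarrow> l" "0 < l"
    and eq: "b 0 * c 0 = d 0 * a 0"
  shows "a 0 = c 0"
proof -
  note pos = agm_seqD(1,2)[OF ab, of 0] agm_seqD(1,2)[OF cd, of 0]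
  have "c 0 / a 0 \<le> 1"
    by (rule agm_seq_scale_le[OF ab cd lim, where k = 0])
       (use pos eq in \<open>simp_all add: field_simps\<close>)
  moreover have "a 0 / c 0 \<le> 1"
    by (rule agm_seq_scale_le[OF cd ab lim(2,1,3), where k = 0])
       (use pos eq in \<open>simp_all add: field_simps\<close>)
  ultimately show ?thesis using pos by simp
qed

lemma agm_seq_theta:
  assumes "0 < r"
  shows "agm_seq (\<lambda>n. (rtheta3 (2 ^ n * r))\<^sup>2) (\<lambda>n. (rtheta4 (2 ^ n * r))\<^sup>2)"
  unfolding agm_seq_def
proof (intro allI conjI)
  fix n :: nat
  have p: "0 < 2 ^ n * r" using assms by simp
  show "0 < (rtheta3 (2 ^ n * r))\<^sup>2" "0 < (rtheta4 (2 ^ n * r))\<^sup>2"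
    using rtheta3_pos[OF p] rtheta4_pos[OF p] by simp_all
  show "(rtheta3 (2 ^ Suc n * r))\<^sup>2 = ((rtheta3 (2 ^ n * r))\<^sup>2 + (rtheta4 (2 ^ n * r))\<^sup>2) / 2"
    using rtheta_identities(1)[OF p] by (simp add: mult.assoc)
  show "((rtheta4 (2 ^ Suc n * r))\<^sup>2)\<^sup>2 = (rtheta3 (2 ^ n * r))\<^sup>2 * (rtheta4 (2 ^ n * r))\<^sup>2"
    using rtheta_identities(2)[OF p] by (simp add: mult.assoc power_mult_distrib)
qed

text \<open>Doubling \<open>y\<close> halves \<open>1 / y\<close>, so the doubling formulas are read
  backwards, with \<open>rtheta2\<close> in the place of \<open>rtheta4\<close>. They give a sum
  instead of a mean; dividing by \<open>y\<close> supplies the missing 1/2.\<close>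

lemma agm_seq_theta_inverse:
  assumes "0 < r"
  shows "agm_seq (\<lambda>n. (rtheta3 (1 / (2 ^ n * r)))\<^sup>2 / (2 ^ n * r)) (\<lambda>n. (rtheta2 (1 / (2 ^ n * r)))\<^sup>2 / (2 ^ n * r))"
  unfolding agm_seq_def
proof (intro allI conjI)
  fix n :: nat
  define y where "y = 2 ^ n * r"
  have p: "0 < y" using assms by (simp add: y_def)
  have p': "0 < 1 / y" and p2: "0 < 1 / (2 * y)" using p by simp_all
  have e: "2 * (1 / (2 * y)) = 1 / y" using p by simp
  have Suc: "2 ^ Suc n * r = 2 * y" by (simp add: y_def)
  show "0 < (rtheta3 (1 / (2 ^ n * r)))\<^sup>2 / (2 ^ n * r)" "0 < (rtheta2 (1 / (2 ^ n * r)))\<^sup>2 / (2 ^ n * r)"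
    using rtheta3_pos[OF p'] rtheta2_pos[OF p'] p unfolding y_def[symmetric] by simp_all
  show "(rtheta3 (1 / (2 ^ Suc n * r)))\<^sup>2 / (2 ^ Suc n * r) =
      ((rtheta3 (1 / (2 ^ n * r)))\<^sup>2 / (2 ^ n * r) + (rtheta2 (1 / (2 ^ n * r)))\<^sup>2 / (2 ^ n * r)) / 2"
    unfolding Suc y_def[symmetric] using rtheta_identities(6)[OF p2] p unfolding e
    by (simp add: field_simps)
  show "((rtheta2 (1 / (2 ^ Suc n * r)))\<^sup>2 / (2 ^ Suc n * r))\<^sup>2 =
      (rtheta3 (1 / (2 ^ n * r)))\<^sup>2 / (2 ^ n * r) * ((rtheta2 (1 / (2 ^ n * r)))\<^sup>2 / (2 ^ n * r))"
    unfolding Suc y_def[symmetric] using rtheta_identities(4)[OF p2] p unfolding e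
    by (simp add: power_mult_distrib power_divide power2_eq_square)
qed

lemma rtheta3_square_tendsto: 
  assumes "0 < r"
  shows "(\<lambda>n. (rtheta3 (2 ^ n * r))\<^sup>2) \<longlonglongrightarrow> 1"
proof -
  have "(\<lambda>n. theta3 (2 ^ n * of_real r)) \<longlonglongrightarrow> 1"
    by (rule filterlim_compose[OF theta3_tendsto filterlim_pow2_mult]) (use assms in simp)
  then have "(\<lambda>n. Re (theta3 (2 ^ n * of_real r))) \<longlonglongrightarrow> Re 1"
    by (rule tendsto_Re)
  then have "(\<lambda>n. rtheta3 (2 ^ n * r)) \<longlonglongrightarrow> 1"
    by (simp add: rtheta3_def)
  from tendsto_power[OF this, of 2] show ?thesis by simp
qed

section \<open>Asymptotics near 0 from the Gaussian integral\<close>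

lemma gauss_integral_tendsto:
  "((\<lambda>T. integral {0..T} (\<lambda>x. exp (- x\<^sup>2))) \<longlongrightarrow> sqrt pi / 2) at_top"
proof -
  let ?f = "\<lambda>x::real. indicator {0..} x *\<^sub>R exp (- x\<^sup>2)"
  have i: "integrable lborel ?f" and v: "integral\<^sup>L lborel ?f = sqrt pi / 2"
    using gaussian_moment_0 by (auto simp: has_bochner_integral_iff)
  have "((\<lambda>T. \<integral>x. indicator {..T} x *\<^sub>R ?f x \<partial>lborel) \<longlongrightarrow> sqrt pi / 2) at_top"
    unfolding v[symmetric] by (rule tendsto_integral_at_top[OF _ i]) simp
  moreover have "(\<integral>x. indicator {..T} x *\<^sub>R ?f x \<partial>lborel) = integral {0..T} (\<lambda>x. exp (- x\<^sup>2))" for T :: real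
  proof -
    have "set_integrable lborel {0..T} (\<lambda>x::real. exp (- x\<^sup>2))"
      by (intro borel_integrable_atLeastAtMost' continuous_intros)
    from set_borel_integral_eq_integral(2)[OF this]
    have "(\<integral>x. indicator {0..T} x *\<^sub>R exp (- x\<^sup>2) \<partial>lborel) = integral {0..T} (\<lambda>x. exp (- x\<^sup>2))"
      by (simp add: set_lebesgue_integral_def)
    moreover have "(\<lambda>x. indicator {..T} x *\<^sub>R ?f x) = (\<lambda>x. indicator {0..T} x *\<^sub>R exp (- x\<^sup>2))"
      by (auto simp: fun_eq_iff indicator_def)
    ultimately show ?thesis by simp
  qed
  ultimately show ?thesis by simp
qed

lemma gauss_riemann_bounds:
  assumes k: "0 < (k::real)"
  shows "k * (\<Sum>n<N. exp (- (real (Suc n) * k)\<^sup>2)) \<le> integral {0..real N * k} (\<lambda>x. exp (- x\<^sup>2))"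
    and "integral {0..real N * k} (\<lambda>x. exp (- x\<^sup>2)) \<le> k * (\<Sum>n<N. exp (- (real n * k)\<^sup>2))"
proof -
  let ?f = "\<lambda>x::real. exp (- x\<^sup>2)"
  have int: "?f integrable_on {a..b}" for a b
    by (intro integrable_continuous_interval continuous_intros)
  have "k * (\<Sum>n<N. ?f (real (Suc n) * k)) \<le> integral {0..real N * k} ?f \<and>
      integral {0..real N * k} ?f \<le> k * (\<Sum>n<N. ?f (real n * k))"
  proof (induction N)
    case (Suc N)
    define a b where "a = real N * k" and "b = real (Suc N) * k"
    have ab: "0 \<le> a" "a \<le> b" "b - a = k" using k by (simp_all add: a_def b_def algebra_simps)
    have c: "integral {0..b} ?f = integral {0..a} ?f + integral {a..b} ?f"
      using ab int by (simp add: Henstock_Kurzweil_Integration.integral_combine)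
    have le: "?f b \<le> ?f x" "?f x \<le> ?f a" if "x \<in> {a..b}" for x
      using that ab by (auto intro!: power_mono)
    have "integral {a..b} (\<lambda>_. ?f b) \<le> integral {a..b} ?f"
      by (rule integral_le[OF _ int]) (use le in auto)
    moreover have "integral {a..b} ?f \<le> integral {a..b} (\<lambda>_. ?f a)"
      by (rule integral_le[OF int]) (use le in auto)
    ultimately have "k * ?f b \<le> integral {a..b} ?f" "integral {a..b} ?f \<le> k * ?f a"
      using ab by simp_all
    with Suc c show ?case by (simp add: a_def[symmetric] b_def[symmetric] distrib_left del: of_nat_Suc)
  qed simp
  then show "k * (\<Sum>n<N. ?f (real (Suc n) * k)) \<le> integral {0..real N * k} ?f"
    "integral {0..real N * k} ?f \<le> k * (\<Sum>n<N. ?f (real n * k))" by auto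
qed

lemma rtheta3_conv_suminf:
  assumes r: "0 < r"
  shows "(\<lambda>n. exp (- (real n * sqrt (pi * r))\<^sup>2)) sums ((rtheta3 r + 1) / 2)"
proof -
  let ?f = "\<lambda>m::int. exp (- (pi * r)) ^ nat (m\<^sup>2)"
  let ?g = "\<lambda>n. exp (- (real n * sqrt (pi * r))\<^sup>2)"
  have fg: "?f (int n) = ?g n" "?f (- int n) = ?g n" for n
  proof -
    have "nat ((int n)\<^sup>2) = n\<^sup>2" by (metis nat_int of_nat_power)
    then show "?f (int n) = ?g n" using r
      by (simp add: power_mult_distrib mult_ac flip: exp_of_nat_mult)
    then show "?f (- int n) = ?g n" by simp
  qed
  have "?f summable_on UNIV" using rtheta3_has_sum[OF r] has_sum_imp_summable by blast
  then have "?f summable_on range int" by (rule summable_on_subset) simp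
  then have "?g summable_on UNIV"
    by (subst (asm) summable_on_reindex) (auto simp: o_def fg)
  then obtain E where E: "(?g has_sum E) UNIV" by (auto simp: summable_on_def)
  have 1: "(?f has_sum E) (range int)"
    by (subst has_sum_reindex) (use E in \<open>auto simp: o_def fg\<close>)
  have "(?f has_sum E) (range (\<lambda>n. - int n))"
    by (subst has_sum_reindex) (use E in \<open>auto simp: o_def fg inj_def\<close>)
  then have 2: "(?f has_sum (E - 1)) (range (\<lambda>n. - int n) - {0})"
    by (rule has_sum_Diff) (auto intro!: has_sum_finiteI)
  have "(?f has_sum (E + (E - 1))) (range int \<union> (range (\<lambda>n. - int n) - {0}))"
    by (rule has_sum_Un_disjoint[OF 1 2]) auto
  also have "range int \<union> (range (\<lambda>n. - int n) - {0}) = UNIV"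
    using int_range_split by (auto simp: image_iff)
  finally have "rtheta3 r = E + (E - 1)"
    using rtheta3_has_sum[OF r] has_sum_unique by blast
  then have "E = (rtheta3 r + 1) / 2" by simp
  with has_sum_imp_sums[OF E] show ?thesis by simp
qed

text \<open>With step \<open>k = sqrt (pi * r)\<close> the one-sided theta series times
  \<open>k\<close> is a Riemann sum of \<open>exp (- x ^ 2)\<close> on the half-line. Left and right
  sums enclose the integral \<open>sqrt pi / 2\<close> and differ by \<open>k\<close>.\<close>

lemma rtheta3_gauss_bounds:
  assumes r: "0 < r"
  shows "\<bar>sqrt (pi * r) * rtheta3 r - sqrt pi\<bar> \<le> sqrt (pi * r)"
proof -
  define k where "k = sqrt (pi * r)"
  have k: "0 < k" using r by (simp add: k_def)
  define E where "E = (rtheta3 r + 1) / 2"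
  have s: "(\<lambda>n. exp (- (real n * k)\<^sup>2)) sums E"
    using rtheta3_conv_suminf[OF r] by (simp add: k_def E_def)
  then have s': "(\<lambda>n. exp (- (real (Suc n) * k)\<^sup>2)) sums (E - 1)"
    by (subst sums_Suc_iff) simp
  have "filterlim (\<lambda>N. real N * k) at_top sequentially"
    using k by real_asymp
  from filterlim_compose[OF gauss_integral_tendsto this]
  have I: "(\<lambda>N. integral {0..real N * k} (\<lambda>x. exp (- x\<^sup>2))) \<longlonglongrightarrow> sqrt pi / 2" .
  have "k * (E - 1) \<le> sqrt pi / 2"
    by (rule LIMSEQ_le[OF tendsto_mult_left[OF s'[unfolded sums_def]] I])
       (use gauss_riemann_bounds(1)[OF k] in blast)
  moreover have "sqrt pi / 2 \<le> k * E"
    by (rule LIMSEQ_le[OF I tendsto_mult_left[OF s[unfolded sums_def]]])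
       (use gauss_riemann_bounds(2)[OF k] in blast)
  moreover have "k * E = k * rtheta3 r / 2 + k / 2"
    by (simp add: E_def field_simps)
  ultimately show ?thesis
    unfolding k_def[symmetric] by (simp add: abs_le_iff algebra_simps)
qed

text \<open>This limit coincides with that of the sequence in \<open>agm_seq_theta\<close>, which
  makes the two AGM iterations comparable.\<close>

lemma rtheta3_inverse_square_tendsto:
  assumes r: "0 < r"
  shows "(\<lambda>n. (rtheta3 (1 / (2 ^ n * r)))\<^sup>2 / (2 ^ n * r)) \<longlonglongrightarrow> 1"
proof -
  define k where "k n = sqrt (pi * (1 / (2 ^ n * r)))" for n
  have k0: "k \<longlonglongrightarrow> 0" unfolding k_def using r by real_asymp
  have "(\<lambda>n. k n * rtheta3 (1 / (2 ^ n * r)) - sqrt pi) \<longlonglongrightarrow> 0"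
  proof (rule Lim_null_comparison[OF _ k0], intro always_eventually allI)
    fix n :: nat
    have "0 < 1 / (2 ^ n * r)" using r by simp
    from rtheta3_gauss_bounds[OF this]
    show "norm (k n * rtheta3 (1 / (2 ^ n * r)) - sqrt pi) \<le> k n"
      by (simp add: k_def)
  qed
  then have "(\<lambda>n. k n * rtheta3 (1 / (2 ^ n * r))) \<longlonglongrightarrow> sqrt pi"
    by (simp add: LIM_zero_iff)
  then have "(\<lambda>n. (k n * rtheta3 (1 / (2 ^ n * r)))\<^sup>2 / pi) \<longlonglongrightarrow> (sqrt pi)\<^sup>2 / pi"
    by (rule tendsto_divide[OF tendsto_power tendsto_const pi_neq_zero])
  moreover have "(k n * rtheta3 (1 / (2 ^ n * r)))\<^sup>2 / pi = (rtheta3 (1 / (2 ^ n * r)))\<^sup>2 / (2 ^ n * r)" for n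
    using r by (simp add: k_def power_mult_distrib)
  ultimately show ?thesis by simp
qed

lemma power4_less_iff:
  assumes "0 \<le> (a::real)" "0 \<le> b"
  shows "a ^ 4 < b ^ 4 \<longleftrightarrow> a < b"
  using assms by (metis power_less_imp_less_base power_strict_mono zero_less_numeral)

text \<open>Both iterations have mean 1. The ratios of their starting pairs are the squares of
  \<open>rtheta4 r / rtheta3 r\<close> and \<open>rtheta2 (1 / r) / rtheta3 (1 / r)\<close>, so
  comparing these moduli decides how the first entries compare.\<close>

lemma rtheta_compare:
  assumes r: "0 < r"
  shows "rtheta2 (1 / r) * rtheta3 r < rtheta4 r * rtheta3 (1 / r) \<Longrightarrow> (rtheta3 r)\<^sup>2 * r < (rtheta3 (1 / r))\<^sup>2"
    and "rtheta4 r * rtheta3 (1 / r) < rtheta2 (1 / r) * rtheta3 r \<Longrightarrow> (rtheta3 (1 / r))\<^sup>2 < (rtheta3 r)\<^sup>2 * r"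
    and "rtheta2 (1 / r) * rtheta3 r = rtheta4 r * rtheta3 (1 / r) \<Longrightarrow> (rtheta3 (1 / r))\<^sup>2 = (rtheta3 r)\<^sup>2 * r"
proof -
  have r': "0 < 1 / r" using r by simp
  note pos = rtheta2_pos[OF r'] rtheta3_pos[OF r'] rtheta3_pos[OF r] rtheta4_pos[OF r]
  note A = agm_seq_theta[OF r] and B = agm_seq_theta_inverse[OF r]
    and a = rtheta3_square_tendsto[OF r] and b = rtheta3_inverse_square_tendsto[OF r]
  have sq: "(u::real)\<^sup>2 / r * v\<^sup>2 < w\<^sup>2 * (z\<^sup>2 / r)" if "u * v < w * z" "0 < u" "0 < v" for u v w z
  proof -
    have "(u * v)\<^sup>2 < (w * z)\<^sup>2" using that by (intro power_strict_mono) auto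
    then show ?thesis using r by (simp add: power_mult_distrib divide_strict_right_mono)
  qed
  have sq': "(u::real)\<^sup>2 * (v\<^sup>2 / r) < w\<^sup>2 / r * z\<^sup>2" if "u * v < w * z" "0 < u" "0 < v" for u v w z
    using sq[OF that] by simp
  show "rtheta2 (1 / r) * rtheta3 r < rtheta4 r * rtheta3 (1 / r) \<Longrightarrow> (rtheta3 r)\<^sup>2 * r < (rtheta3 (1 / r))\<^sup>2"
    using agm_seq_strict_antimono[OF B A b a] sq[of "rtheta2 (1 / r)" "rtheta3 r" "rtheta4 r" "rtheta3 (1 / r)"] pos r
    by (simp add: field_simps)
  show "rtheta4 r * rtheta3 (1 / r) < rtheta2 (1 / r) * rtheta3 r \<Longrightarrow> (rtheta3 (1 / r))\<^sup>2 < (rtheta3 r)\<^sup>2 * r"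
    using agm_seq_strict_antimono[OF A B a b] sq'[of "rtheta4 r" "rtheta3 (1 / r)" "rtheta2 (1 / r)" "rtheta3 r"] pos r
    by (simp add: field_simps)
  assume "rtheta2 (1 / r) * rtheta3 r = rtheta4 r * rtheta3 (1 / r)"
  then have "(rtheta2 (1 / r) * rtheta3 r)\<^sup>2 = (rtheta4 r * rtheta3 (1 / r))\<^sup>2" by simp
  then have "(rtheta2 (1 / r))\<^sup>2 / r * (rtheta3 r)\<^sup>2 = (rtheta4 r)\<^sup>2 * ((rtheta3 (1 / r))\<^sup>2 / r)"
    by (simp add: power_mult_distrib)
  then show "(rtheta3 (1 / r))\<^sup>2 = (rtheta3 r)\<^sup>2 * r"
    using agm_seq_eq[OF B A b a] r by (simp add: field_simps)
qed

text \<open>By Jacobi's quartic identity a strict inequality between the moduli at \<open>r\<close> entails the same inequality at \<open>1 / r\<close>;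
  the two resulting comparisons of \<open>rtheta3 (1 / r)\<close> with \<open>rtheta3 r\<close> contradict each other.\<close>

lemma rtheta_inverse:
  assumes r: "0 < r"
  shows "rtheta2 (1 / r) * rtheta3 r = rtheta4 r * rtheta3 (1 / r)"
    and "(rtheta3 (1 / r))\<^sup>2 = (rtheta3 r)\<^sup>2 * r"
proof -
  have r': "0 < 1 / r" using r by simp
  note pos = rtheta2_pos[OF r'] rtheta3_pos[OF r'] rtheta4_pos[OF r'] rtheta2_pos[OF r] rtheta3_pos[OF r] rtheta4_pos[OF r]
  note Q = rtheta_identities(5)[OF r] rtheta_identities(5)[OF r']
  \<comment> \<open>After inserting the quartic identities at \<open>r\<close> and
    \<open>1 / r\<close>, the common product \<open>rtheta3 r ^ 4 * rtheta3 (1 / r) ^ 4\<close>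
    cancels.\<close>
  have flip: "(rtheta2 (1 / r) * rtheta3 r) ^ 4 - (rtheta4 r * rtheta3 (1 / r)) ^ 4 =
      (rtheta2 r * rtheta3 (1 / r)) ^ 4 - (rtheta4 (1 / r) * rtheta3 r) ^ 4"
    using Q by (simp add: algebra_simps)
  show *: "rtheta2 (1 / r) * rtheta3 r = rtheta4 r * rtheta3 (1 / r)"
  proof (rule linorder_cases[of "rtheta2 (1 / r) * rtheta3 r" "rtheta4 r * rtheta3 (1 / r)"])
    assume l: "rtheta2 (1 / r) * rtheta3 r < rtheta4 r * rtheta3 (1 / r)"
    then have "(rtheta2 (1 / r) * rtheta3 r) ^ 4 < (rtheta4 r * rtheta3 (1 / r)) ^ 4"
      using pos by (intro power_strict_mono) auto
    then have "(rtheta2 r * rtheta3 (1 / r)) ^ 4 < (rtheta4 (1 / r) * rtheta3 r) ^ 4"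
      using flip by simp
    then have "rtheta2 r * rtheta3 (1 / r) < rtheta4 (1 / r) * rtheta3 r"
      using pos by (subst (asm) power4_less_iff) auto
    then have "(rtheta3 (1 / r))\<^sup>2 * (1 / r) < (rtheta3 r)\<^sup>2"
      using rtheta_compare(1)[OF r'] by simp
    with rtheta_compare(1)[OF r l] r show ?thesis by (simp add: field_simps)
  next
    assume l: "rtheta4 r * rtheta3 (1 / r) < rtheta2 (1 / r) * rtheta3 r"
    then have "(rtheta4 r * rtheta3 (1 / r)) ^ 4 < (rtheta2 (1 / r) * rtheta3 r) ^ 4"
      using pos by (intro power_strict_mono) auto
    then have "(rtheta4 (1 / r) * rtheta3 r) ^ 4 < (rtheta2 r * rtheta3 (1 / r)) ^ 4"
      using flip by simp
    then have "rtheta4 (1 / r) * rtheta3 r < rtheta2 r * rtheta3 (1 / r)"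
      using pos by (subst (asm) power4_less_iff) auto
    then have "(rtheta3 r)\<^sup>2 < (rtheta3 (1 / r))\<^sup>2 * (1 / r)"
      using rtheta_compare(2)[OF r'] by simp
    with rtheta_compare(2)[OF r l] r show ?thesis by (simp add: field_simps)
  qed
  show "(rtheta3 (1 / r))\<^sup>2 = (rtheta3 r)\<^sup>2 * r"
    by (rule rtheta_compare(3)[OF r *])
qed

lemma rtheta3_inverse:
  assumes r: "0 < r"
  shows "rtheta3 (1 / r) = sqrt r * rtheta3 r"
proof -
  have "(rtheta3 (1 / r))\<^sup>2 = (sqrt r * rtheta3 r)\<^sup>2"
    using rtheta_inverse(2)[OF r] r by (simp add: power_mult_distrib)
  then show ?thesis
    using rtheta3_pos[of "1 / r"] rtheta3_pos[OF r] r by (simp add: less_imp_le)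
qed

lemma rtheta2_1: "rtheta2 1 = rtheta4 1"
  using rtheta_inverse(1)[of 1] rtheta3_pos[of 1] by simp

lemma theta2_1: "theta2 1 = theta4 1"
  using rtheta2_1 theta2_of_real[of 1] theta4_of_real[of 1] by simp

text \<open>The functional equation is differentiated at its fixed point 1. It is available on the
  positive reals only, hence the vector derivatives along the real axis.\<close>

lemma logderiv_theta3_1: "logderiv theta3 1 = - 1 / 4"
proof -
  have d: "(theta3 has_field_derivative deriv theta3 1) (at 1)"
    by (rule DERIV_theta) simp
  then have "(theta3 has_field_derivative deriv theta3 1) (at (1 / 1))" by simp
  moreover have "((\<lambda>z::complex. 1 / z) has_field_derivative - 1) (at 1)"
    by (auto intro!: derivative_eq_intros)
  ultimately have "((\<lambda>z. theta3 (1 / z)) has_field_derivative deriv theta3 1 * - 1) (at 1)"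
    using DERIV_chain2[where f = theta3 and g = "\<lambda>z. 1 / z" and x = 1] by blast
  then have "((\<lambda>z. theta3 (1 / z)) has_field_derivative - deriv theta3 1) (at (of_real 1))" by simp
  then have 1: "((\<lambda>r. theta3 (1 / of_real r)) has_vector_derivative - deriv theta3 1) (at 1)"
    by (rule has_vector_derivative_real_field)
  have "((\<lambda>z. csqrt z * theta3 z) has_field_derivative theta3 1 / 2 + deriv theta3 1) (at (of_real 1))"
    using d by (auto intro!: derivative_eq_intros)
  then have 2: "((\<lambda>r. csqrt (of_real r) * theta3 (of_real r)) has_vector_derivative theta3 1 / 2 + deriv theta3 1) (at 1)"
    by (rule has_vector_derivative_real_field)
  have eq: "csqrt (of_real r) * theta3 (of_real r) = theta3 (1 / of_real r)" if "r \<in> {0<..}" for r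
  proof -
    have r: "0 < r" and r': "0 < 1 / r" using that by simp_all
    have "csqrt (of_real r) * theta3 (of_real r) = of_real (sqrt r * rtheta3 r)"
      by (simp only: of_real_sqrt[OF less_imp_le[OF r]] theta3_of_real[OF r] of_real_mult)
    also have "\<dots> = theta3 (of_real (1 / r))"
      unfolding theta3_of_real[OF r'] rtheta3_inverse[OF r] ..
    finally show ?thesis by simp
  qed
  from 2 have "((\<lambda>r. theta3 (1 / of_real r)) has_vector_derivative theta3 1 / 2 + deriv theta3 1) (at 1)"
    by (rule has_vector_derivative_transform_within_open[where S = "{0<..}"]) (use eq in auto)
  with 1 have "- deriv theta3 1 = theta3 1 / 2 + deriv theta3 1"
    by (rule vector_derivative_unique_at)
  then have "theta3 1 = - 4 * deriv theta3 1" by algebra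
  then show ?thesis
    using theta3_nonzero[of 1] by (simp add: logderiv_def)
qed

section \<open>The lemniscate integral\<close>

text \<open>Integrand of Gauss's complete elliptic integral in algebraic form:
  \<open>u = b * tan t\<close> gives the trigonometric one. Its integral over the real line is
  \<open>pi\<close> divided by the AGM of \<open>a\<close> and \<open>b\<close>.\<close>

definition ell_kernel :: "real \<Rightarrow> real \<Rightarrow> real \<Rightarrow> real" where
  "ell_kernel a b u = 1 / sqrt ((u\<^sup>2 + a\<^sup>2) * (u\<^sup>2 + b\<^sup>2))"

lemma inverse_1_plus_square_integral:
  "(\<lambda>u::real. inverse (1 + u\<^sup>2)) absolutely_integrable_on UNIV"
  "integral UNIV (\<lambda>u::real. inverse (1 + u\<^sup>2)) = pi"
proof -
  have e: "einterval (-\<infinity>) \<infinity> = UNIV" by (auto simp: einterval_def)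
  have i: "set_integrable lborel UNIV (\<lambda>u::real. inverse (1 + u\<^sup>2))"
    using integrable_inverse_1_plus_square unfolding e .
  then show "(\<lambda>u::real. inverse (1 + u\<^sup>2)) absolutely_integrable_on UNIV"
    unfolding set_integrable_def by (rule integrable_completion[THEN iffD2, rotated]) measurable
  show "integral UNIV (\<lambda>u::real. inverse (1 + u\<^sup>2)) = pi"
    using LBINT_inverse_1_plus_square set_borel_integral_eq_integral(2)[OF i]
    by (simp add: interval_lebesgue_integral_def e)
qed

text \<open>Enclosure between multiples of the Cauchy density, from which both integrability and the
  limit for \<open>a\<close> and \<open>b\<close> tending to 1 are obtained.\<close>

lemma ell_kernel_bounds:
  assumes "0 < m" "m \<le> a" "m \<le> b" "m \<le> 1" "a \<le> M" "b \<le> M" "1 \<le> M"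
  shows "ell_kernel a b u \<le> inverse (1 + u\<^sup>2) / m\<^sup>2" "inverse (1 + u\<^sup>2) / M\<^sup>2 \<le> ell_kernel a b u"
proof -
  have u: "0 < 1 + u\<^sup>2" by (simp add: add_pos_nonneg)
  have lo: "m\<^sup>2 * (1 + u\<^sup>2) \<le> u\<^sup>2 + c\<^sup>2" if "m \<le> c" for c
  proof -
    have "m\<^sup>2 \<le> c\<^sup>2" "m\<^sup>2 \<le> 1"
      using that assms by (auto intro!: power_mono power_le_one)
    moreover from this(2) have "m\<^sup>2 * u\<^sup>2 \<le> 1 * u\<^sup>2"
      by (rule mult_right_mono) simp
    ultimately show ?thesis by (simp add: algebra_simps)
  qed
  have hi: "u\<^sup>2 + c\<^sup>2 \<le> M\<^sup>2 * (1 + u\<^sup>2)" if "0 \<le> c" "c \<le> M" for c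
  proof -
    have "c\<^sup>2 \<le> M\<^sup>2" "1 \<le> M\<^sup>2"
      using that assms by (auto intro!: power_mono one_le_power)
    moreover from this(2) have "1 * u\<^sup>2 \<le> M\<^sup>2 * u\<^sup>2"
      by (rule mult_right_mono) simp
    ultimately show ?thesis by (simp add: algebra_simps)
  qed
  have "(m\<^sup>2 * (1 + u\<^sup>2))\<^sup>2 \<le> (u\<^sup>2 + a\<^sup>2) * (u\<^sup>2 + b\<^sup>2)"
    unfolding power2_eq_square[of "m\<^sup>2 * (1 + u\<^sup>2)"]
    using lo assms u by (intro mult_mono) auto
  then have "m\<^sup>2 * (1 + u\<^sup>2) \<le> sqrt ((u\<^sup>2 + a\<^sup>2) * (u\<^sup>2 + b\<^sup>2))"
    by (rule real_le_rsqrt)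
  moreover have "0 < m\<^sup>2 * (1 + u\<^sup>2)" using assms u by simp
  ultimately have "1 / sqrt ((u\<^sup>2 + a\<^sup>2) * (u\<^sup>2 + b\<^sup>2)) \<le> 1 / (m\<^sup>2 * (1 + u\<^sup>2))"
    by (intro frac_le) simp_all
  then show "ell_kernel a b u \<le> inverse (1 + u\<^sup>2) / m\<^sup>2"
    by (simp add: ell_kernel_def divide_inverse mult_ac)
  have "(u\<^sup>2 + a\<^sup>2) * (u\<^sup>2 + b\<^sup>2) \<le> (M\<^sup>2 * (1 + u\<^sup>2))\<^sup>2"
    unfolding power2_eq_square[of "M\<^sup>2 * (1 + u\<^sup>2)"]
    using hi assms u by (intro mult_mono) auto
  then have "sqrt ((u\<^sup>2 + a\<^sup>2) * (u\<^sup>2 + b\<^sup>2)) \<le> M\<^sup>2 * (1 + u\<^sup>2)"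
    using u by (intro real_le_lsqrt) auto
  moreover have "0 < sqrt ((u\<^sup>2 + a\<^sup>2) * (u\<^sup>2 + b\<^sup>2))"
    using assms by (auto intro!: mult_pos_pos add_nonneg_pos)
  ultimately have "1 / (M\<^sup>2 * (1 + u\<^sup>2)) \<le> 1 / sqrt ((u\<^sup>2 + a\<^sup>2) * (u\<^sup>2 + b\<^sup>2))"
    using assms u by (intro divide_left_mono) (auto intro!: mult_pos_pos)
  then show "inverse (1 + u\<^sup>2) / M\<^sup>2 \<le> ell_kernel a b u"
    by (simp add: ell_kernel_def divide_inverse mult_ac)
qed

lemma ell_kernel_integrable:
  assumes "0 < a" "0 < b"
  shows "ell_kernel a b absolutely_integrable_on UNIV"
proof (rule measurable_bounded_by_integrable_imp_absolutely_integrable)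
  define m where "m = min 1 (min a b)"
  have "continuous_on UNIV (ell_kernel a b)"
    unfolding ell_kernel_def[abs_def] using assms
    by (intro continuous_intros) (auto simp: add_nonneg_eq_0_iff)
  then show "ell_kernel a b \<in> borel_measurable (lebesgue_on UNIV)"
    using continuous_imp_measurable_on_sets_lebesgue by fastforce
  show "(\<lambda>u. inverse (1 + u\<^sup>2) / m\<^sup>2) integrable_on UNIV"
    using inverse_1_plus_square_integral(1)
    by (intro integrable_on_divide) (simp add: absolutely_integrable_on_def)
  show "norm (ell_kernel a b u) \<le> inverse (1 + u\<^sup>2) / m\<^sup>2" for u
    using ell_kernel_bounds(1)[of m a b "max 1 (max a b)" u] assms
    by (simp add: m_def ell_kernel_def)
qed auto

lemma ell_kernel_integral_bounds:
  assumes "0 < m" "m \<le> a" "m \<le> b" "m \<le> 1" "a \<le> M" "b \<le> M" "1 \<le> M"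
  shows "integral UNIV (ell_kernel a b) \<le> pi / m\<^sup>2" "pi / M\<^sup>2 \<le> integral UNIV (ell_kernel a b)"
proof -
  have i: "ell_kernel a b integrable_on UNIV"
    using ell_kernel_integrable[of a b] assms by (simp add: absolutely_integrable_on_def)
  have j: "(\<lambda>u. inverse (1 + u\<^sup>2) / c) integrable_on UNIV" for c :: real
    using inverse_1_plus_square_integral(1)
    by (intro integrable_on_divide) (simp add: absolutely_integrable_on_def)
  have k: "integral UNIV (\<lambda>u. inverse (1 + u\<^sup>2) / c) = pi / c" for c :: real
    using inverse_1_plus_square_integral(2) by simp
  show "integral UNIV (ell_kernel a b) \<le> pi / m\<^sup>2"
    unfolding k[symmetric] by (rule integral_le[OF i j]) (use ell_kernel_bounds[OF assms] in auto)
  show "pi / M\<^sup>2 \<le> integral UNIV (ell_kernel a b)"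
    unfolding k[symmetric] by (rule integral_le[OF j i]) (use ell_kernel_bounds[OF assms] in auto)
qed

lemma ell_kernel_even:
  assumes "0 < a" "0 < b"
  shows "integral UNIV (ell_kernel a b) = 2 * integral {0<..} (ell_kernel a b)"
proof -
  let ?k = "ell_kernel a b"
  have ai: "?k absolutely_integrable_on S" if "S \<in> sets lebesgue" for S
    using ell_kernel_integrable[OF assms] that by (rule set_integrable_subset) auto
  have P: "?k absolutely_integrable_on {0<..}" and N: "?k absolutely_integrable_on {..<0}"
    by (auto intro!: ai)
  have im: "uminus ` {0<..} = {..<(0::real)}" by (auto simp: image_iff intro: bexI[of _ "- _"])
  have "integral (uminus ` {0<..}) ?k = integral {0<..} ?k"
  proof -
    have "(\<lambda>x. \<bar>- 1\<bar> * ?k (- x)) absolutely_integrable_on {0<..} \<and> integral {0<..} (\<lambda>x. \<bar>- 1\<bar> * ?k (- x)) = integral {0<..} ?k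
      \<longleftrightarrow> ?k absolutely_integrable_on (uminus ` {0<..}) \<and> integral (uminus ` {0<..}) ?k = integral {0<..} ?k"
      by (rule has_absolute_integral_change_of_variables_1') (auto intro!: derivative_eq_intros)
    moreover have "?k (- x) = ?k x" for x by (simp add: ell_kernel_def)
    ultimately show ?thesis using P by simp
  qed
  then have e: "integral {..<0} ?k = integral {0<..} ?k" by (simp add: im)
  have "(?k has_integral (integral {0<..} ?k + integral {..<0} ?k)) ({0<..} \<union> {..<0})"
  proof (rule has_integral_Un)
    have "{0<..} \<inter> {..<0} = ({} :: real set)" by auto
    then show "negligible ({0<..} \<inter> {..<0::real})" by simp
  qed (use P N in \<open>auto simp: absolutely_integrable_on_def\<close>)
  then have "(?k has_integral (integral {0<..} ?k + integral {..<0} ?k)) UNIV"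
  proof (rule has_integral_spike_set_eq[THEN iffD1, rotated 2])
    show "negligible {x \<in> {0<..} \<union> {..<0} - UNIV. ?k x \<noteq> 0}" by simp
    show "negligible {x \<in> UNIV - ({0<..} \<union> {..<0}). ?k x \<noteq> 0}"
      by (rule negligible_subset[of "{0::real}"]) auto
  qed
  then show ?thesis using e by (simp add: integral_unique)
qed

text \<open>The substitution \<open>u = (t - a * b / t) / 2\<close> turns
  \<open>u ^ 2 + a * b\<close> into a perfect square and \<open>u ^ 2 + ((a + b) / 2) ^ 2\<close>
  into the product \<open>(t ^ 2 + a ^ 2) * (t ^ 2 + b ^ 2)\<close> over
  \<open>(2 * t) ^ 2\<close>.\<close>

lemma landen_integrand:
  assumes a: "0 < a" and b: "0 < (b::real)" and t: "0 < t"
  shows "(1 + a * b / t\<^sup>2) / 2 * ell_kernel ((a + b) / 2) (sqrt (a * b)) ((t - a * b / t) / 2) = 2 * ell_kernel a b t"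
proof -
  have 1: "((t - a * b / t) / 2)\<^sup>2 + (sqrt (a * b))\<^sup>2 = ((t + a * b / t) / 2)\<^sup>2"
    using a b t by (simp add: field_simps power2_eq_square)
  have 2: "((t - a * b / t) / 2)\<^sup>2 + ((a + b) / 2)\<^sup>2 = ((t\<^sup>2 + a\<^sup>2) * (t\<^sup>2 + b\<^sup>2)) / (2 * t)\<^sup>2"
    using t by (simp add: field_simps power2_eq_square)
  have p: "0 < (t + a * b / t) / 2" using a b t by (simp add: add_pos_pos)
  have 3: "sqrt ((((t - a * b / t) / 2)\<^sup>2 + ((a + b) / 2)\<^sup>2) * (((t - a * b / t) / 2)\<^sup>2 + (sqrt (a * b))\<^sup>2)) =
      sqrt ((t\<^sup>2 + a\<^sup>2) * (t\<^sup>2 + b\<^sup>2)) / (2 * t) * ((t + a * b / t) / 2)"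
    unfolding 1 2 using p t by (simp only: real_sqrt_mult real_sqrt_divide real_sqrt_abs abs_of_pos mult_pos_pos zero_less_numeral)
  have 4: "(1 + a * b / t\<^sup>2) / 2 = (t + a * b / t) / 2 / t"
    using t by (simp add: field_simps power2_eq_square)
  have 5: "w / t * (1 / (s / (2 * t) * w)) = 2 * (1 / s)" if "w \<noteq> 0" for w s
    using that t by simp
  have "(t + a * b / t) / 2 \<noteq> 0" using p by simp
  from 5[OF this] show ?thesis unfolding ell_kernel_def 3 4 .
qed

lemma landen_surj:
  assumes c: "0 < (c::real)"
  shows "(\<lambda>t. (t - c / t) / 2) ` {0<..} = UNIV"
proof -
  have ex: "\<exists>t>0. u = (t - c / t) / 2" for u
  proof (intro exI conjI)
    \<comment> \<open>The witness \<open>u + ?s\<close> is the positive root of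
      \<open>t ^ 2 - 2 * u * t - c = 0\<close>.\<close>
    let ?s = "sqrt (u\<^sup>2 + c)"
    have s: "?s\<^sup>2 = u\<^sup>2 + c" using c by (simp add: add_nonneg_pos less_imp_le)
    have "\<bar>u\<bar> < ?s" using c by (intro real_less_rsqrt) simp
    then show p: "0 < u + ?s" by linarith
    have "(u + ?s) * (?s - u) = c" using s by algebra
    then have "c / (u + ?s) = ?s - u"
      using p by (metis less_irrefl nonzero_mult_div_cancel_left)
    then show "u = (u + ?s - c / (u + ?s)) / 2" by simp
  qed
  have "u \<in> (\<lambda>t. (t - c / t) / 2) ` {0<..}" for u
  proof -
    obtain t where "0 < t" "u = (t - c / t) / 2" using ex by blast
    then show ?thesis by (intro image_eqI[of _ _ t]) auto
  qed
  then show ?thesis by blast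
qed

lemma landen_inj:
  assumes c: "0 < (c::real)"
  shows "inj_on (\<lambda>t. (t - c / t) / 2) {0<..}"
proof (rule linorder_inj_onI)
  fix x y :: real
  assume "x < y" "x \<in> {0<..}" "y \<in> {0<..}"
  then have "c / y < c / x" using c by (simp add: divide_strict_left_mono)
  with \<open>x < y\<close> show "(x - c / x) / 2 \<noteq> (y - c / y) / 2" by simp
qed auto

text \<open>The substitution maps the half-line bijectively onto the line; evenness of
  \<open>ell_kernel a b\<close> turns the factor 2 of \<open>landen_integrand\<close> back into an
  integral over the line.\<close>

lemma ell_kernel_landen:
  assumes a: "0 < a" and b: "0 < b"
  shows "integral UNIV (ell_kernel ((a + b) / 2) (sqrt (a * b))) = integral UNIV (ell_kernel a b)"
proof -
  let ?g = "\<lambda>t. (t - a * b / t) / 2" and ?k = "ell_kernel ((a + b) / 2) (sqrt (a * b))"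
  have ab: "0 < a * b" using a b by simp
  have "(\<lambda>t. \<bar>(1 + a * b / t\<^sup>2) / 2\<bar> * ?k (?g t)) absolutely_integrable_on {0<..} \<and>
      integral {0<..} (\<lambda>t. \<bar>(1 + a * b / t\<^sup>2) / 2\<bar> * ?k (?g t)) = integral UNIV ?k \<longleftrightarrow>
      ?k absolutely_integrable_on (?g ` {0<..}) \<and> integral (?g ` {0<..}) ?k = integral UNIV ?k"
  proof (rule has_absolute_integral_change_of_variables_1')
    show "(?g has_field_derivative (1 + a * b / t\<^sup>2) / 2) (at t within {0<..})" if "t \<in> {0<..}" for t
      using that by (auto intro!: derivative_eq_intros simp: power2_eq_square)
  qed (use landen_inj[OF ab] in auto)
  then have "integral {0<..} (\<lambda>t. \<bar>(1 + a * b / t\<^sup>2) / 2\<bar> * ?k (?g t)) = integral UNIV ?k"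
    using ell_kernel_integrable[of "(a + b) / 2" "sqrt (a * b)"] a b unfolding landen_surj[OF ab] by simp
  also have "integral {0<..} (\<lambda>t. \<bar>(1 + a * b / t\<^sup>2) / 2\<bar> * ?k (?g t)) = integral {0<..} (\<lambda>t. 2 * ell_kernel a b t)"
  proof (rule Henstock_Kurzweil_Integration.integral_cong)
    fix t :: real assume "t \<in> {0<..}"
    then have "0 < t" by simp
    from landen_integrand[OF a b this] show "\<bar>(1 + a * b / t\<^sup>2) / 2\<bar> * ?k (?g t) = 2 * ell_kernel a b t"
      using ab by (simp add: add_nonneg_nonneg less_imp_le)
  qed
  finally show ?thesis by (simp add: ell_kernel_even[OF a b])
qed

text \<open>Landen's transformation keeps the integral constant along the iteration, and the
  enclosure by \<open>pi / m ^ 2\<close> and \<open>pi / M ^ 2\<close> closes up as both entries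
  tend to 1.\<close>

lemma agm_seq_integral:
  assumes ab: "agm_seq a b" and "a \<longlonglongrightarrow> 1"
  shows "integral UNIV (ell_kernel (a 0) (b 0)) = pi"
proof -
  note pos = agm_seqD(1,2)[OF ab]
  have bS: "b (Suc n) = sqrt (a n * b n)" for n
    using agm_seqD(4)[OF ab, of n] pos by (metis abs_of_pos real_sqrt_abs)
  have eq: "integral UNIV (ell_kernel (a n) (b n)) = integral UNIV (ell_kernel (a 0) (b 0))" for n
  proof (induction n)
    case (Suc n)
    then show ?case using ell_kernel_landen[OF pos] by (simp add: bS agm_seqD(3)[OF ab])
  qed simp
  \<comment> \<open>The limit of \<open>b\<close> follows from that of \<open>a\<close>, since the
    arithmetic mean step can be solved for \<open>b n\<close>.\<close>
  have "(\<lambda>n. 2 * a (Suc n) - a n) \<longlonglongrightarrow> 2 * 1 - 1"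
    by (intro tendsto_intros LIMSEQ_Suc assms)
  moreover have "2 * a (Suc n) - a n = b n" for n
    unfolding agm_seqD(3)[OF ab] by (simp add: field_simps)
  ultimately have b1: "b \<longlonglongrightarrow> 1" by simp
  define m M where "m n = min 1 (min (a n) (b n))" and "M n = max 1 (max (a n) (b n))" for n
  have "m \<longlonglongrightarrow> min 1 (min 1 1)" "M \<longlonglongrightarrow> max 1 (max 1 1)"
    unfolding m_def M_def by (intro tendsto_intros assms b1)+
  then have "m \<longlonglongrightarrow> 1" "M \<longlonglongrightarrow> 1" by simp_all
  moreover have "(\<lambda>n. pi / (x n)\<^sup>2) \<longlonglongrightarrow> pi / 1\<^sup>2" if "x \<longlonglongrightarrow> 1" for x :: "nat \<Rightarrow> real"
    by (intro tendsto_intros that) simp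
  ultimately have "(\<lambda>n. pi / (m n)\<^sup>2) \<longlonglongrightarrow> pi / 1\<^sup>2" "(\<lambda>n. pi / (M n)\<^sup>2) \<longlonglongrightarrow> pi / 1\<^sup>2"
    by blast+
  moreover have "integral UNIV (ell_kernel (a 0) (b 0)) \<le> pi / (m n)\<^sup>2"
    and "pi / (M n)\<^sup>2 \<le> integral UNIV (ell_kernel (a 0) (b 0))" for n
    using ell_kernel_integral_bounds[of "m n" "a n" "b n" "M n"] pos[of n]
    unfolding eq[of n] by (auto simp: m_def M_def)
  ultimately have "integral UNIV (ell_kernel (a 0) (b 0)) \<le> pi / 1\<^sup>2"
    "pi / 1\<^sup>2 \<le> integral UNIV (ell_kernel (a 0) (b 0))"
    by (blast intro: LIMSEQ_le_const LIMSEQ_le_const2)+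
  then show ?thesis by simp
qed

text \<open>The substitution is \<open>w = s\<^sup>4\<close>, \<open>s = c / sqrt (u\<^sup>2 + c\<^sup>2)\<close>.\<close>

lemma lemniscate_integrand:
  assumes c: "0 < (c::real)" and w: "0 < w" "w < 1"
  shows "c / (4 * w * sqrt w * sqrt (1 / sqrt w - 1)) * ell_kernel (sqrt 2 * c) c (c * sqrt (1 / sqrt w - 1)) =
    1 / (4 * c) * (w powr (1 / 4 - 1) * (1 - w) powr (1 / 2 - 1))"
proof -
  define q where "q = w powr (1 / 4)"
  have q: "0 < q" "q < 1" using w powr_less_mono2[of "1 / 4" w 1] by (simp_all add: q_def)
  have wq: "w = q ^ 4" using w by (simp add: q_def powr_powr flip: powr_numeral)
  have sw: "sqrt w = q\<^sup>2" using q by (simp add: wq real_sqrt_unique)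
  have q2: "0 < 1 - q\<^sup>2" using q by (simp add: power_less_one_iff)
  have A: "sqrt (1 / q\<^sup>2 - 1) = sqrt (1 - q\<^sup>2) / q"
  proof -
    have "1 / q\<^sup>2 - 1 = (1 - q\<^sup>2) / q\<^sup>2" using q by (simp add: field_simps)
    then show ?thesis using q by (simp add: real_sqrt_divide)
  qed
  have E: "(c * sqrt (1 / q\<^sup>2 - 1))\<^sup>2 = c\<^sup>2 * (1 / q\<^sup>2 - 1)"
    using q q2 by (simp add: power_mult_distrib field_simps)
  have "((c * sqrt (1 / q\<^sup>2 - 1))\<^sup>2 + (sqrt 2 * c)\<^sup>2) * ((c * sqrt (1 / q\<^sup>2 - 1))\<^sup>2 + c\<^sup>2) = (c\<^sup>2 / q\<^sup>2)\<^sup>2 * (1 + q\<^sup>2)"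
    unfolding E using q by (simp add: field_simps power2_eq_square)
  then have B: "ell_kernel (sqrt 2 * c) c (c * sqrt (1 / sqrt w - 1)) = q\<^sup>2 / (c\<^sup>2 * sqrt (1 + q\<^sup>2))"
    using c q by (simp add: ell_kernel_def sw real_sqrt_mult)
  have C: "w powr (1 / 4 - 1) = 1 / q ^ 3"
  proof -
    have "w powr (1 / 4 - 1) = w powr (1 / 4) / w" using powr_diff[of w "1 / 4" 1] w by simp
    also have "\<dots> = q / q ^ 4" using wq by (simp add: q_def)
    finally show ?thesis using q by (simp add: power4_eq_xxxx power3_eq_cube)
  qed
  have "1 - w = (1 - q\<^sup>2) * (1 + q\<^sup>2)" by (simp add: wq algebra_simps power2_eq_square power4_eq_xxxx)
  then have D: "(1 - w) powr (1 / 2 - 1) = 1 / (sqrt (1 - q\<^sup>2) * sqrt (1 + q\<^sup>2))"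
    using q2 by (simp add: powr_minus_divide powr_half_sqrt real_sqrt_mult)
  show ?thesis unfolding B C D unfolding sw A unfolding wq
    using c q q2 by (simp add: field_simps power4_eq_xxxx power3_eq_cube power2_eq_square)
qed

lemma lemniscate_deriv:
  assumes w: "0 < w" "w < 1"
  shows "((\<lambda>w. c * sqrt (1 / sqrt w - 1)) has_field_derivative - (c / (4 * w * sqrt w * sqrt (1 / sqrt w - 1)))) (at w within S)"
proof -
  have p: "0 < 1 / sqrt w - 1" using w by simp
  show ?thesis
    using w p by (auto intro!: derivative_eq_intros simp: field_simps)
qed

lemma lemniscate_bij:
  assumes c: "0 < (c::real)"
  shows "(\<lambda>w. c * sqrt (1 / sqrt w - 1)) ` {0<..<1} = {0<..}" "inj_on (\<lambda>w. c * sqrt (1 / sqrt w - 1)) {0<..<1}"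
proof -
  have ex: "\<exists>w. 0 < w \<and> w < 1 \<and> u = c * sqrt (1 / sqrt w - 1)" if u: "0 < u" for u
  proof (intro exI conjI)
    \<comment> \<open>Inverse substitution: \<open>1 / sqrt w = 1 + (u / c) ^ 2\<close>, so
      \<open>w = (1 / v) ^ 2\<close>.\<close>
    define v where "v = 1 + (u / c)\<^sup>2"
    have v: "1 < v" using u c by (simp add: v_def)
    have "sqrt ((1 / v)\<^sup>2) = 1 / v" using v by simp
    then show "u = c * sqrt (1 / sqrt ((1 / v)\<^sup>2) - 1)" using u c by (simp add: v_def)
    show "0 < (1 / v)\<^sup>2" "(1 / v)\<^sup>2 < 1" using v by (simp_all add: power_less_one_iff abs_square_less_1)
  qed
  have "u \<in> (\<lambda>w. c * sqrt (1 / sqrt w - 1)) ` {0<..<1}" if "0 < u" for u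
  proof -
    obtain w where "0 < w" "w < 1" "u = c * sqrt (1 / sqrt w - 1)" using ex \<open>0 < u\<close> by blast
    then show ?thesis by (intro image_eqI[of _ _ w]) auto
  qed
  then show "(\<lambda>w. c * sqrt (1 / sqrt w - 1)) ` {0<..<1} = {0<..}"
    using c by auto
  show "inj_on (\<lambda>w. c * sqrt (1 / sqrt w - 1)) {0<..<1}"
    using c by (auto simp: inj_on_def)
qed

text \<open>The ratio \<open>sqrt 2\<close> is the lemniscatic case: in the variable
  \<open>s\<close> the integrand is \<open>1 / (c * sqrt (1 - s ^ 4))\<close> on the unit interval,
  and \<open>w = s ^ 4\<close> makes it a Beta integral.\<close>

lemma ell_kernel_lemniscate:
  assumes c: "0 < c"
  shows "integral UNIV (ell_kernel (sqrt 2 * c) c) = Beta (1 / 4) (1 / 2) / (2 * c)"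
proof -
  let ?g = "\<lambda>w. c * sqrt (1 / sqrt w - 1)" and ?k = "ell_kernel (sqrt 2 * c) c"
  let ?g' = "\<lambda>w. - (c / (4 * w * sqrt w * sqrt (1 / sqrt w - 1)))"
  let ?B = "\<lambda>w::real. w powr (1 / 4 - 1) * (1 - w) powr (1 / 2 - 1)"
  have c2: "0 < sqrt 2 * c" using c by simp
  have P: "?k absolutely_integrable_on {0<..}"
    using ell_kernel_integrable[OF c2 c] by (rule set_integrable_subset) auto
  have "(\<lambda>w. \<bar>?g' w\<bar> * ?k (?g w)) absolutely_integrable_on {0<..<1} \<and>
      integral {0<..<1} (\<lambda>w. \<bar>?g' w\<bar> * ?k (?g w)) = integral {0<..} ?k \<longleftrightarrow>
      ?k absolutely_integrable_on (?g ` {0<..<1}) \<and> integral (?g ` {0<..<1}) ?k = integral {0<..} ?k"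
    by (rule has_absolute_integral_change_of_variables_1')
       (use lemniscate_deriv[of _ c] lemniscate_bij(2)[OF c] in auto)
  then have "integral {0<..} ?k = integral {0<..<1} (\<lambda>w. \<bar>?g' w\<bar> * ?k (?g w))"
    using P unfolding lemniscate_bij(1)[OF c] by simp
  also have "\<dots> = integral {0<..<1} (\<lambda>w. 1 / (4 * c) * ?B w)"
  proof (rule Henstock_Kurzweil_Integration.integral_cong)
    fix w :: real assume w: "w \<in> {0<..<1}"
    then have "\<bar>?g' w\<bar> = c / (4 * w * sqrt w * sqrt (1 / sqrt w - 1))" using c by simp
    then show "\<bar>?g' w\<bar> * ?k (?g w) = 1 / (4 * c) * ?B w"
      using lemniscate_integrand[OF c] w by simp
  qed
  also have "\<dots> = 1 / (4 * c) * integral {0<..<1} ?B" by simp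
  also have "integral {0<..<1} ?B = Beta (1 / 4) (1 / 2)"
  proof (rule integral_unique)
    have "(?B has_integral Beta (1 / 4) (1 / 2)) {0..1}" by (rule has_integral_Beta_real) auto
    then show "(?B has_integral Beta (1 / 4) (1 / 2)) {0<..<1}"
      by (simp add: has_integral_Icc_iff_Ioo)
  qed
  finally show ?thesis using ell_kernel_even[OF c2 c] by simp
qed

section \<open>Gamma values and the constant Omega\<close>

lemma Gamma_quarter_reflection: "Gamma (1 / 4) * Gamma (3 / 4) = sqrt 2 * pi"
proof -
  have "complex_of_real (Gamma (1 / 4) * Gamma (3 / 4)) = Gamma (of_real (1 / 4)) * Gamma (1 - of_real (1 / 4))"
    by (simp add: Gamma_complex_of_real[symmetric])
  also have "\<dots> = of_real pi / sin (of_real pi * of_real (1 / 4))"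
    by (rule Gamma_reflection_complex)
  also have "\<dots> = of_real (pi / sin (pi * (1 / 4)))"
    by (simp only: of_real_divide[symmetric] of_real_mult[symmetric] sin_of_real)
  also have "pi / sin (pi * (1 / 4)) = sqrt 2 * pi"
    by (simp add: sin_45 field_simps)
  finally show ?thesis by (simp only: of_real_eq_iff)
qed

text \<open>The reflection formula eliminates \<open>Gamma (3 / 4)\<close> from the Beta value, and
  squaring clears the roots of 2 and \<open>pi\<close>.\<close>

lemma Beta_quarter_half: "(Beta (1 / 4) (1 / 2 :: real))\<^sup>2 = Gamma (1 / 4) ^ 4 / (2 * pi)"
proof -
  have g: "0 < Gamma (1 / 4 :: real)" "0 < Gamma (3 / 4 :: real)" by simp_all
  have "Gamma (3 / 4) = sqrt 2 * pi / Gamma (1 / 4)"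
    using Gamma_quarter_reflection g(1) by (metis less_irrefl nonzero_mult_div_cancel_left)
  then have "Beta (1 / 4) (1 / 2 :: real) = Gamma (1 / 4) * sqrt pi / (sqrt 2 * pi / Gamma (1 / 4))"
    by (simp add: Beta_def Gamma_one_half_real)
  also have "\<dots> = (Gamma (1 / 4))\<^sup>2 * sqrt pi / (sqrt 2 * pi)"
    by (simp add: power2_eq_square)
  also have "(\<dots>)\<^sup>2 = Gamma (1 / 4) ^ 4 / (2 * pi)"
    by (simp add: power_mult_distrib power_divide power2_eq_square[of pi] flip: power_mult)
  finally show ?thesis .
qed

text \<open>Since \<open>rtheta2 1 = rtheta4 1\<close>, the quartic identity makes the AGM starting
  pair at 1 equal to \<open>(sqrt 2 * c, c)\<close>. Its mean is 1, so the lemniscate integral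
  equals \<open>pi\<close>, which determines \<open>c\<close>.\<close>

lemma Omega_conv_theta3: "Omega = pi\<^sup>2 * rtheta3 1 ^ 8 / 2"
proof -
  define c where "c = (rtheta4 1)\<^sup>2"
  have c: "0 < c" using rtheta4_pos[of 1] by (simp add: c_def)
  have q: "rtheta3 1 ^ 4 = 2 * c\<^sup>2"
    using rtheta_identities(5)[of 1] rtheta2_1 by (simp add: c_def)
  then have "((rtheta3 1)\<^sup>2)\<^sup>2 = (sqrt 2 * c)\<^sup>2" by (simp add: power_mult_distrib)
  then have "(rtheta3 1)\<^sup>2 = sqrt 2 * c" using c by (subst (asm) power2_eq_iff_nonneg) auto
  moreover have "integral UNIV (ell_kernel ((rtheta3 (2 ^ 0 * 1))\<^sup>2) ((rtheta4 (2 ^ 0 * 1))\<^sup>2)) = pi"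
    by (rule agm_seq_integral[OF agm_seq_theta rtheta3_square_tendsto]) simp_all
  ultimately have "Beta (1 / 4) (1 / 2) / (2 * c) = pi"
    using ell_kernel_lemniscate[OF c] by (simp add: c_def)
  then have "Beta (1 / 4) (1 / 2) = 2 * c * pi" using c by (simp add: field_simps)
  then have "Gamma (1 / 4) ^ 4 / (2 * pi) = (2 * c * pi)\<^sup>2"
    using Beta_quarter_half by simp
  then have "Gamma (1 / 4) ^ 4 = 4 * pi ^ 3 * rtheta3 1 ^ 4"
    unfolding q by (simp add: field_simps power2_eq_square power3_eq_cube)
  then have "(Gamma (1 / 4 :: real) ^ 4)\<^sup>2 = 16 * pi ^ 6 * rtheta3 1 ^ 8"
    by (simp add: power_mult_distrib flip: power_mult)
  then have "Gamma (1 / 4 :: real) ^ 8 = 16 * pi ^ 6 * rtheta3 1 ^ 8"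
    by (simp flip: power_mult)
  also have "\<dots> = 16 * (pi ^ 4 * pi\<^sup>2) * rtheta3 1 ^ 8" by (simp flip: power_add)
  finally have "Omega = 16 * (pi ^ 4 * pi\<^sup>2) * rtheta3 1 ^ 8 / (32 * pi ^ 4)"
    by (simp only: Omega_def)
  also have "\<dots> = pi\<^sup>2 * rtheta3 1 ^ 8 / 2"
  proof -
    have "16 * (p * q) * t / (32 * p) = q * t / 2" if "p \<noteq> 0" for p q t :: real
      using that by simp
    from this[of "pi ^ 4"] show ?thesis by (simp only: power_not_zero pi_neq_zero not_False_eq_True)
  qed
  finally show ?thesis .
qed

section \<open>Taylor coefficients\<close>

text \<open>The recursion \<open>Q\<^bsub>n+1\<^esub> = (1 - y\<^sup>2) (2 Q\<^sub>n' + n (n - 1/2) Q\<^bsub>n-1\<^esub>)\<close> of the covariant derivatives,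
  multiplied by \<open>2 ^ (n div 2)\<close> to clear denominators.\<close>

fun theta_poly :: "nat \<Rightarrow> int poly" where
  "theta_poly 0 = 1"
| "theta_poly (Suc 0) = 0"
| "theta_poly (Suc (Suc n)) = [:1, 0, - 1:] *
     (smult (if even n then 4 else 2) (pderiv (theta_poly (Suc n))) +
      smult ((int n + 1) * (2 * int n + 1)) (theta_poly n))"

lemma coeff_1_minus_square_mult:
  fixes p :: "int poly"
  shows "coeff ([:1, 0, - 1:] * p) i = coeff p i - (if i < 2 then 0 else coeff p (i - 2))"
proof -
  have "[:1, 0, - 1:] * p = p - pCons 0 (pCons 0 p)" by simp
  then show ?thesis by (auto simp: coeff_pCons split: nat.split)
qed

text \<open>Differentiation flips the parity and the factor \<open>1 - y ^ 2\<close> keeps it.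
  Consequently the odd-indexed polynomials vanish at \<open>y = 0\<close>.\<close>

lemma theta_poly_parity: "odd (i + n) \<Longrightarrow> coeff (theta_poly n) i = 0"
proof (induction n arbitrary: i rule: theta_poly.induct)
  case (1 i)
  then show ?case by (auto simp: coeff_eq_0 odd_pos)
next
  case (3 n i)
  have "coeff (theta_poly (Suc n)) (Suc j) = 0" "coeff (theta_poly n) j = 0" if "odd (j + n)" for j
    using 3 that by auto
  moreover have "odd (i - 2 + n)" if "\<not> i < 2" using 3(3) that by auto
  ultimately show ?case using 3(3)
    by (auto simp: coeff_1_minus_square_mult coeff_pderiv simp del: mult_pCons_left)
qed simp

text \<open>The constant terms supply the prescribed initial values of \<open>d\<close>. The
  recursion has order two, so the odd-indexed polynomials are computed on the way.\<close>

lemma theta_poly_values: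
  "theta_poly 2 = [:1, 0, - 1:]"
  "theta_poly 4 = [:- 1, 0, 34, 0, - 33:]"
  "theta_poly 6 = [:51, 0, - 633, 0, 2137, 0, - 1555:]"
  "theta_poly 8 = [:849, 0, 18684, 0, - 107226, 0, 187772, 0, - 100079:]"
  "theta_poly 10 = [:- 26199, 0, 2315763, 0, - 5760102, 0, 665830, 0, 7865165, 0, - 5060457:]"
  "theta_poly 12 = [:1341999, 0, - 149679162, 0, 2537037921, 0, - 8367166188, 0, 11195500545, 0, - 6663755962, 0, 1446720847:]"
proof -
  have step: "theta_poly (n + 2) = [:1, 0, - 1:] * (smult (if even n then 4 else 2) (pderiv q) +
      smult ((int n + 1) * (2 * int n + 1)) p)" if "theta_poly n = p" "theta_poly (n + 1) = q" for n p q
    using that by simp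
  have 0: "theta_poly 0 = 1" and 1: "theta_poly 1 = 0" by simp_all
  show 2: "theta_poly 2 = [:1, 0, - 1:]"
    by (simp add: numeral_2_eq_2 one_pCons)
  have 3: "theta_poly 3 = [:0, - 4, 0, 4:]"
    by (simp add: numeral_3_eq_3 one_pCons pderiv_pCons)
  show 4: "theta_poly 4 = [:- 1, 0, 34, 0, - 33:]"
    using step[of 2 "theta_poly 2" "theta_poly 3"] by (simp add: 2 3 pderiv_pCons)
  have 5: "theta_poly 5 = [:0, 24, 0, - 176, 0, 152:]"
    using step[of 3 "theta_poly 3" "theta_poly 4"] by (simp add: 3 4 pderiv_pCons)
  show 6: "theta_poly 6 = [:51, 0, - 633, 0, 2137, 0, - 1555:]"
    using step[of 4 "theta_poly 4" "theta_poly 5"] by (simp add: 4 5 pderiv_pCons)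
  have 7: "theta_poly 7 = [:0, - 948, 0, 6428, 0, - 14108, 0, 8628:]"
    using step[of 5 "theta_poly 5" "theta_poly 6"] by (simp add: 5 6 pderiv_pCons)
  show 8: "theta_poly 8 = [:849, 0, 18684, 0, - 107226, 0, 187772, 0, - 100079:]"
    using step[of 6 "theta_poly 6" "theta_poly 7"] by (simp add: 6 7 pderiv_pCons)
  have 9: "theta_poly 9 = [:0, - 39024, 0, - 47424, 0, 646752, 0, - 1126208, 0, 565904:]"
    using step[of 7 "theta_poly 7" "theta_poly 8"] by (simp add: 7 8 pderiv_pCons)
  show 10: "theta_poly 10 = [:- 26199, 0, 2315763, 0, - 5760102, 0, 665830, 0, 7865165, 0, - 5060457:]"
    using step[of 8 "theta_poly 8" "theta_poly 9"] by (simp add: 8 9 pderiv_pCons)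
  have 11: "theta_poly 11 = [:0, 1848492, 0, - 56939868, 0, 185964216, 0, - 219009720, 0, 94449500, 0, - 6312620:]"
    using step[of 9 "theta_poly 9" "theta_poly 10"] by (simp add: 9 10 pderiv_pCons)
  show "theta_poly 12 = [:1341999, 0, - 149679162, 0, 2537037921, 0, - 8367166188, 0, 11195500545, 0, - 6663755962, 0, 1446720847:]"
    using step[of 10 "theta_poly 10" "theta_poly 11"] by (simp add: 10 11 pderiv_pCons)
qed

abbreviation cpoly :: "int poly \<Rightarrow> complex poly" where
  "cpoly p \<equiv> map_poly of_int p"

lemma cpoly_theta_poly_rec:
  assumes "0 < n"
  shows "poly (cpoly (theta_poly (Suc n))) y = (1 - y\<^sup>2) *
    ((if odd n then 4 else 2) * poly (pderiv (cpoly (theta_poly n))) y +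
     of_nat n * (2 * of_nat n - 1) * poly (cpoly (theta_poly (n - 1))) y)"
proof -
  obtain m where n: "n = Suc m" using assms by (cases n) auto
  have hom: "cpoly (p * q) = cpoly p * cpoly q" "cpoly (p + q) = cpoly p + cpoly q"
    "cpoly (smult c p) = smult (of_int c) (cpoly p)" "cpoly (pderiv p) = pderiv (cpoly p)" for p q c
    by (simp_all add: poly_eq_iff coeff_map_poly coeff_mult coeff_pderiv)
  have q: "cpoly [:1, 0, - 1:] = [:1, 0, - 1:]"
    by (simp add: map_poly_pCons)
  \<comment> \<open>The index is now one below the result instead of two, so the parity condition
    flips.\<close>
  have "of_int (if even m then 4 else 2) = (if odd n then 4 else 2 :: complex)"
    "of_int ((int m + 1) * (2 * int m + 1)) = (of_nat n * (2 * of_nat n - 1) :: complex)"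
    by (simp_all add: n algebra_simps)
  then have "cpoly (theta_poly (Suc n)) = [:1, 0, - 1:] * (smult (if odd n then 4 else 2) (pderiv (cpoly (theta_poly n))) +
      smult (of_nat n * (2 * of_nat n - 1)) (cpoly (theta_poly (n - 1))))"
    unfolding n theta_poly.simps hom q by simp
  then show ?thesis
    by (simp add: power2_eq_square del: mult_pCons_left)
qed

text \<open>This is \<open>1 - 2 * \<lambda>\<close> for the modular function
  \<open>\<lambda> = theta2 ^ 4 / theta3 ^ 4\<close>. It is odd under exchanging
  \<open>theta2\<close> and \<open>theta4\<close>, hence 0 at the fixed point.\<close>

definition ratio_y :: "complex \<Rightarrow> complex" where
  "ratio_y x = (theta4 x ^ 4 - theta2 x ^ 4) / theta3 x ^ 4"

text \<open>The quotient has weight 0, so only differences of logarithmic derivatives enter; these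
  are fourth powers, and \<open>1 - y ^ 2\<close> is
  \<open>4 * theta2 ^ 4 * theta4 ^ 4 / theta3 ^ 8\<close>.\<close>

lemma ratio_y_deriv:
  assumes x: "0 < Re x"
  shows "(ratio_y has_field_derivative of_real pi / 2 * theta3 x ^ 4 * (1 - (ratio_y x)\<^sup>2)) (at x)"
proof -
  define a b s u v w where "a = theta2 x ^ 4" and "b = theta4 x ^ 4" and "s = theta3 x ^ 4"
    and "u = logderiv theta2 x" and "v = logderiv theta4 x" and "w = logderiv theta3 x"
  have s0: "s \<noteq> 0" using theta_nonzero[OF x] by (simp add: s_def)
  have sab: "s = a + b" using jacobi_quartic[OF x] by (simp add: s_def a_def b_def)
  have uw: "u - w = - (of_real pi / 4) * b" and wv: "w - v = - (of_real pi / 4) * a"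
    using logderiv_theta2_minus_theta3[OF x] logderiv_theta3_minus_theta4[OF x]
    by (simp_all add: u_def v_def w_def a_def b_def)
  have d3: "((\<lambda>x. theta3 x ^ 4) has_field_derivative 4 * w * s) (at x)"
    using DERIV_theta[OF x] theta_nonzero[OF x]
    by (auto intro!: derivative_eq_intros simp: w_def s_def logderiv_def power4_eq_xxxx power3_eq_cube)
  have D1: "(ratio_y has_field_derivative ((4 * v * b - 4 * u * a) * s - (b - a) * (4 * w * s)) / (s * s)) (at x)"
    unfolding ratio_y_def[abs_def]
    using DERIV_divide[OF DERIV_diff[OF DERIV_theta_pow4(2,1)[OF x]] d3] s0
    by (simp add: a_def b_def s_def u_def v_def)
  have D2: "((4 * v * b - 4 * u * a) * s - (b - a) * (4 * w * s)) / (s * s) =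
      of_real pi / 2 * s * (1 - ((b - a) / s)\<^sup>2)"
  proof -
    have "(4 * v * b - 4 * u * a) * s - (b - a) * (4 * w * s) = - (4 * s) * ((w - v) * b + (u - w) * a)"
      by algebra
    also have "\<dots> = 2 * of_real pi * s * (a * b)"
      unfolding uw wv by (simp add: algebra_simps)
    also have "4 * (a * b) = s\<^sup>2 - (b - a)\<^sup>2"
      unfolding sab by algebra
    then have "a * b = (s\<^sup>2 - (b - a)\<^sup>2) / 4"
      by (metis nonzero_mult_div_cancel_left zero_neq_numeral)
    finally have num: "(4 * v * b - 4 * u * a) * s - (b - a) * (4 * w * s) = 2 * of_real pi * s * ((s\<^sup>2 - (b - a)\<^sup>2) / 4)" .
    show ?thesis unfolding num using s0 by (simp add: field_simps power2_eq_square)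
  qed
  show ?thesis using D1 unfolding D2 by (simp only: a_def b_def s_def ratio_y_def)
qed

text \<open>The factor \<open>fact (2 * n)\<close> in the denominator removes the binomial and Pochhammer coefficients
  from the expansion of the ordinary derivatives in covariant ones.\<close>

definition serre :: "nat \<Rightarrow> complex \<Rightarrow> complex" where
  "serre n x = of_real pi ^ n / (2 ^ (n div 2) * fact (2 * n)) * theta3 x ^ (4 * n + 1) *
     poly (cpoly (theta_poly n)) (ratio_y x)"

text \<open>A form \<open>f\<close> of weight \<open>k\<close> has the covariant derivative
  \<open>f' - k * conn * f\<close>. The factor 2 is the inverse of the weight 1/2 and makes
  \<open>theta3\<close> flat, whence \<open>theta_poly 1 = 0\<close>.\<close>

definition conn :: "complex \<Rightarrow> complex" where
  "conn x = 2 * logderiv theta3 x"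

text \<open>The curvature: what remains of the derivative of \<open>conn\<close> after subtracting
  its square, a form of weight 4.\<close>

definition curv :: "complex \<Rightarrow> complex" where
  "curv x = (of_real pi)\<^sup>2 / 4 * (theta2 x ^ 4 * theta4 x ^ 4)"

lemma conn_deriv:
  assumes x: "0 < Re x"
  shows "(conn has_field_derivative (conn x)\<^sup>2 + curv x) (at x)"
proof -
  have "(conn has_field_derivative 2 * deriv (logderiv theta3) x) (at x)"
    unfolding conn_def[abs_def] by (rule DERIV_cmult[OF DERIV_logderiv(1)[OF x]])
  then show ?thesis
    by (simp add: deriv_logderiv_theta3[OF x] conn_def curv_def power2_eq_square algebra_simps)
qed

lemma curv_conv_ratio_y:
  assumes x: "0 < Re x"
  shows "curv x = (of_real pi)\<^sup>2 / 16 * theta3 x ^ 8 * (1 - (ratio_y x)\<^sup>2)"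
proof -
  define a b s where "a = theta2 x ^ 4" and "b = theta4 x ^ 4" and "s = theta3 x ^ 4"
  have s0: "s \<noteq> 0" using theta_nonzero[OF x] by (simp add: s_def)
  have sab: "s = a + b" using jacobi_quartic[OF x] by (simp add: s_def a_def b_def)
  have s8: "theta3 x ^ 8 = s\<^sup>2" by (simp add: s_def flip: power_mult)
  have "s\<^sup>2 * (1 - ((b - a) / s)\<^sup>2) = s\<^sup>2 - (b - a)\<^sup>2"
    using s0 by (simp add: field_simps power2_eq_square)
  also have "\<dots> = 4 * (a * b)" unfolding sab by algebra
  finally have "s\<^sup>2 * (1 - (ratio_y x)\<^sup>2) = 4 * (a * b)" by (simp add: ratio_y_def a_def b_def s_def)
  then have "(of_real pi)\<^sup>2 / 16 * s\<^sup>2 * (1 - (ratio_y x)\<^sup>2) = (of_real pi)\<^sup>2 / 16 * (4 * (a * b))"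
    by (simp only: mult.assoc)
  then show ?thesis by (simp add: curv_def s8 a_def b_def)
qed

text \<open>The power \<open>theta3 ^ (4 * n + 1)\<close> is flat of weight
  \<open>2 * n + 1 / 2\<close>, so covariantly only the polynomial in \<open>y\<close> is
  differentiated, and the recursion of \<open>theta_poly\<close> rewrites the result. The
  normalisation turns its coefficient \<open>n * (n - 1 / 2)\<close> into the plain factor
  \<open>curv x\<close>.\<close>

lemma serre_deriv:
  assumes x: "0 < Re x"
  shows "(serre n has_field_derivative
      (of_nat n + 1) * (of_nat n + 1 / 2) * serre (Suc n) x + (2 * of_nat n + 1 / 2) * conn x * serre n x
      - curv x * (case n of 0 \<Rightarrow> 0 | Suc m \<Rightarrow> serre m x)) (at x)"
proof -
  define t y where "t = theta3 x" and "y = ratio_y x"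
  define R where "R k = poly (cpoly (theta_poly k)) y" for k
  define R' where "R' = poly (pderiv (cpoly (theta_poly n))) y"
  define p :: complex where "p = of_real pi"
  define C :: complex where "C = p ^ n / (2 ^ (n div 2) * fact (2 * n))"
  have dt: "(theta3 has_field_derivative logderiv theta3 x * t) (at x)"
    using DERIV_theta(2)[OF x] theta_nonzero[OF x] by (simp add: logderiv_def t_def)
  have "((\<lambda>x. theta3 x ^ (4 * n + 1)) has_field_derivative of_nat (4 * n + 1) * (logderiv theta3 x * t) * t ^ (4 * n)) (at x)"
    using DERIV_power[OF dt, of "4 * n + 1"] by (simp add: t_def mult_ac)
  moreover have "((\<lambda>x. poly (cpoly (theta_poly n)) (ratio_y x)) has_field_derivative R' * (p / 2 * t ^ 4 * (1 - y\<^sup>2))) (at x)"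
    using DERIV_chain2[OF poly_DERIV ratio_y_deriv[OF x]] by (simp add: R'_def p_def t_def y_def)
  ultimately have "((\<lambda>x. C * (theta3 x ^ (4 * n + 1) * poly (cpoly (theta_poly n)) (ratio_y x))) has_field_derivative
      C * (of_nat (4 * n + 1) * (logderiv theta3 x * t) * t ^ (4 * n) * R n + R' * (p / 2 * t ^ 4 * (1 - y\<^sup>2)) * t ^ (4 * n + 1))) (at x)"
    using DERIV_mult by (intro DERIV_cmult) (fastforce simp: R_def t_def y_def)
  moreover have "serre n = (\<lambda>x. C * (theta3 x ^ (4 * n + 1) * poly (cpoly (theta_poly n)) (ratio_y x)))"
    by (simp add: serre_def[abs_def] C_def p_def mult.assoc)
  ultimately have D: "(serre n has_field_derivative
      C * (of_nat (4 * n + 1) * (logderiv theta3 x * t) * t ^ (4 * n) * R n + R' * (p / 2 * t ^ 4 * (1 - y\<^sup>2)) * t ^ (4 * n + 1))) (at x)"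
    by simp
  have sn: "(2 * of_nat n + 1 / 2) * conn x * serre n x = C * (of_nat (4 * n + 1) * (logderiv theta3 x * t) * t ^ (4 * n) * R n)"
    by (simp add: conn_def serre_def C_def p_def t_def R_def y_def field_simps)
  have K: "C * (R' * (p / 2 * t ^ 4 * (1 - y\<^sup>2)) * t ^ (4 * n + 1)) =
      (of_nat n + 1) * (of_nat n + 1 / 2) * serre (Suc n) x - curv x * (case n of 0 \<Rightarrow> 0 | Suc m \<Rightarrow> serre m x)"
  proof (cases n)
    \<comment> \<open>Both sides vanish: \<open>theta_poly 0\<close> is constant and
      \<open>theta_poly 1\<close> is 0.\<close>
    case 0
    then show ?thesis by (simp add: serre_def R'_def)
  next
    case (Suc m)
    define E :: complex where "E = p ^ Suc n / fact (2 * n) * t ^ (4 * n + 5) * (1 - y\<^sup>2)"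
    have f1: "(fact (2 * Suc n) :: complex) = 4 * ((of_nat n + 1) * (of_nat n + 1 / 2)) * fact (2 * n)"
      by (simp add: field_simps)
    have f2: "(fact (2 * n) :: complex) = 2 * of_nat n * (2 * of_nat n - 1) * fact (2 * m)"
      by (simp add: Suc field_simps)
    have nz: "(of_nat n + 1 :: complex) \<noteq> 0" "(of_nat n + 1 / 2 :: complex) \<noteq> 0"
      "(of_nat n :: complex) \<noteq> 0" "(2 * of_nat n - 1 :: complex) \<noteq> 0"
    proof -
      have e: "(of_nat n + 1 :: complex) = of_nat (n + 1)" "2 * (of_nat n + 1 / 2 :: complex) = of_nat (2 * n + 1)"
        "(2 * of_nat n - 1 :: complex) = of_nat (2 * m + 1)" by (simp_all add: Suc)
      have nz: "(of_nat (n + 1) :: complex) \<noteq> 0" "(of_nat (2 * n + 1) :: complex) \<noteq> 0"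
        "(of_nat (2 * m + 1) :: complex) \<noteq> 0"
        unfolding of_nat_eq_0_iff by simp_all
      show "(of_nat n + 1 :: complex) \<noteq> 0" "(2 * of_nat n - 1 :: complex) \<noteq> 0"
        unfolding e by (rule nz)+
      show "(of_nat n + 1 / 2 :: complex) \<noteq> 0"
        using nz(2) unfolding e(2)[symmetric] by (metis mult_zero_right)
    qed (simp add: Suc del: of_nat_Suc)
    have tt: "t ^ (4 * n + 1) * t ^ 4 = t ^ (4 * n + 5)" "t ^ (4 * m + 1) * t ^ 8 = t ^ (4 * n + 5)"
    proof -
      have "4 * n + 1 + 4 = 4 * n + 5" "4 * m + 1 + 8 = 4 * n + 5" by (simp_all add: Suc)
      then show "t ^ (4 * n + 1) * t ^ 4 = t ^ (4 * n + 5)" "t ^ (4 * m + 1) * t ^ 8 = t ^ (4 * n + 5)"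
        by (simp_all only: power_add[symmetric])
    qed
    have s1: "(of_nat n + 1) * (of_nat n + 1 / 2) * serre (Suc n) x =
        E / (4 * 2 ^ (Suc n div 2)) * ((if odd n then 4 else 2) * R' + of_nat n * (2 * of_nat n - 1) * R m)"
    proof -
      have "serre (Suc n) x = p ^ Suc n / (2 ^ (Suc n div 2) * (4 * ((of_nat n + 1) * (of_nat n + 1 / 2)) * fact (2 * n))) *
          t ^ (4 * n + 5) * ((1 - y\<^sup>2) * ((if odd n then 4 else 2) * R' + of_nat n * (2 * of_nat n - 1) * R m))"
        unfolding serre_def f1 using cpoly_theta_poly_rec[of n y]
        by (simp add: Suc p_def t_def y_def R'_def R_def add_ac)
      moreover have "a * b * (P / (D * (4 * (a * b) * f)) * T * (Y * Z)) = P / f * T * Y / (4 * D) * Z"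
        if "a \<noteq> 0" "b \<noteq> 0" for a b P D f T Y Z :: complex
        using that by (cases "D = 0"; cases "f = 0") (simp_all add: field_simps)
      ultimately show ?thesis
        unfolding E_def using nz(1,2) by metis
    qed
    have s2: "curv x * serre m x = E / (8 * 2 ^ (m div 2)) * (of_nat n * (2 * of_nat n - 1) * R m)"
    proof -
      have "curv x * serre m x = (p\<^sup>2 * p ^ m) / (16 * 2 ^ (m div 2) * fact (2 * m)) * (t ^ (4 * m + 1) * t ^ 8) * (1 - y\<^sup>2) * R m"
        by (simp add: curv_conv_ratio_y[OF x] serre_def p_def t_def y_def R_def mult_ac)
      also have "p\<^sup>2 * p ^ m = p ^ Suc n" by (simp add: Suc power2_eq_square)
      finally have "curv x * serre m x = p ^ Suc n / (16 * 2 ^ (m div 2) * fact (2 * m)) * t ^ (4 * n + 5) * (1 - y\<^sup>2) * R m"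
        unfolding tt .
      moreover have "P / (16 * D * f) * T * Y * Z = P / (2 * a * b * f) * T * Y / (8 * D) * (a * b * Z)"
        if "a \<noteq> 0" "b \<noteq> 0" for a b P D f T Y Z :: complex
        using that by (cases "D = 0"; cases "f = 0") (simp_all add: field_simps)
      ultimately show ?thesis
        unfolding E_def f2 using nz(3,4) by metis
    qed
    have l: "C * (R' * (p / 2 * t ^ 4 * (1 - y\<^sup>2)) * t ^ (4 * n + 1)) = E / (2 * 2 ^ (n div 2)) * R'"
      unfolding C_def E_def tt(1)[symmetric] by (simp add: field_simps)
    show ?thesis
    \<comment> \<open>The exponent \<open>n div 2\<close> grows only at every second step, so the
      powers of 2 balance differently for the two parities.\<close>
    proof (cases "even n")
      case True
      then have "Suc n div 2 = n div 2" "n div 2 = Suc (m div 2)" using Suc by presburger+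
      then show ?thesis using True unfolding l s1 using s2
        by (simp add: Suc[symmetric]) (simp add: Suc field_simps)
    next
      case False
      then have "Suc n div 2 = Suc (n div 2)" "n div 2 = m div 2" using Suc by presburger+
      then show ?thesis using False unfolding l s1 using s2
        by (simp add: Suc[symmetric]) (simp add: Suc field_simps)
    qed
  qed
  have "C * (u + v) = z1 + z2 - z3" if "z2 = C * u" "C * v = z1 - z3" for u v z1 z2 z3
    using that by (simp add: distrib_left)
  from DERIV_cong[OF D this[OF sn K]] show ?thesis .
qed

text \<open>Algebraic core of the induction, with \<open>p k\<close> for
  \<open>\<phi> ^ k / fact k\<close>. For \<open>k = n - r\<close> the coefficients of
  \<open>p (Suc n - r) * E r\<close> add up by \<open>k (k + 1) + (2 r + 1/2) (k + 1) + r (r - 1/2)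
  = (n + 1) (n + 1/2)\<close>.\<close>

lemma taylor_sum_identity:
  fixes p E :: "nat \<Rightarrow> complex" and \<phi> \<psi> :: complex
  assumes p: "\<And>k. \<phi> * p k = (of_nat k + 1) * p (Suc k)"
  shows "(\<Sum>r\<le>n. (case n - r of 0 \<Rightarrow> 0 | Suc j \<Rightarrow> p j) * (\<phi>\<^sup>2 + \<psi>) * E r +
      p (n - r) * ((of_nat r + 1) * (of_nat r + 1 / 2) * E (Suc r) + (2 * of_nat r + 1 / 2) * \<phi> * E r
        - \<psi> * (case r of 0 \<Rightarrow> 0 | Suc j \<Rightarrow> E j))) =
    (of_nat n + 1) * (of_nat n + 1 / 2) * (\<Sum>r\<le>Suc n. p (Suc n - r) * E r)"
proof -
  define P where "P k = (case k of 0 \<Rightarrow> 0 | Suc j \<Rightarrow> p j)" for k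
  have PP: "P k * \<phi>\<^sup>2 = of_nat k * (of_nat k + 1) * p (Suc k)" for k
  proof (cases k)
    case (Suc j)
    have "P k * \<phi>\<^sup>2 = \<phi> * (\<phi> * p j)" by (simp add: P_def Suc power2_eq_square)
    also have "\<dots> = (of_nat j + 1) * (\<phi> * p (Suc j))" by (simp add: p mult_ac)
    also have "\<dots> = of_nat k * (of_nat k + 1) * p (Suc k)" by (simp add: p Suc algebra_simps)
    finally show ?thesis .
  qed (simp add: P_def)
  let ?c = "\<lambda>r. of_nat (n - r) * (of_nat (n - r) + 1) + (2 * of_nat r + 1 / 2) * (of_nat (n - r) + 1) :: complex"
  let ?d = "\<lambda>r. of_nat r * (of_nat r - 1 / 2) :: complex"
  \<comment> \<open>An index shift by one: the curvature from differentiating the connection cancels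
    the curvature from the covariant derivatives.\<close>
  have "(\<Sum>r\<le>n. P (n - r) * E r) = (\<Sum>r\<le>n. p (n - r) * (case r of 0 \<Rightarrow> 0 | Suc j \<Rightarrow> E j))"
  proof (cases n)
    case (Suc m)
    have "(\<Sum>r\<le>Suc m. P (Suc m - r) * E r) = (\<Sum>r\<le>m. p (m - r) * E r)"
      by (simp add: P_def Suc_diff_le)
    also have "\<dots> = (\<Sum>r\<le>Suc m. p (Suc m - r) * (case r of 0 \<Rightarrow> 0 | Suc j \<Rightarrow> E j))"
      by (subst sum.atMost_Suc_shift) simp
    finally show ?thesis by (simp add: Suc)
  qed (simp add: P_def)
  then have 0: "\<psi> * (\<Sum>r\<le>n. P (n - r) * E r) - \<psi> * (\<Sum>r\<le>n. p (n - r) * (case r of 0 \<Rightarrow> 0 | Suc j \<Rightarrow> E j)) = 0"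
    by simp
  \<comment> \<open>The added term at \<open>r = 0\<close> vanishes because
    \<open>?d 0 = 0\<close>.\<close>
  have 1: "(\<Sum>r\<le>n. p (n - r) * ((of_nat r + 1) * (of_nat r + 1 / 2)) * E (Suc r)) = (\<Sum>r\<le>Suc n. ?d r * (p (Suc n - r) * E r))"
    by (subst sum.atMost_Suc_shift) (simp add: algebra_simps)
  have "P (n - r) * (\<phi>\<^sup>2 + \<psi>) * E r + p (n - r) * ((of_nat r + 1) * (of_nat r + 1 / 2) * E (Suc r) + (2 * of_nat r + 1 / 2) * \<phi> * E r
        - \<psi> * (case r of 0 \<Rightarrow> 0 | Suc j \<Rightarrow> E j)) =
      ?c r * (p (Suc n - r) * E r) + p (n - r) * ((of_nat r + 1) * (of_nat r + 1 / 2)) * E (Suc r)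
      + \<psi> * (P (n - r) * E r) - \<psi> * (p (n - r) * (case r of 0 \<Rightarrow> 0 | Suc j \<Rightarrow> E j))" if "r \<le> n" for r
  proof -
    have e: "Suc n - r = Suc (n - r)" using that by simp
    have gen: "P (n - r) * (\<phi>\<^sup>2 + \<psi>) * E r + p (n - r) * (a * E' + b * \<phi> * E r - \<psi> * z) =
      (P (n - r) * \<phi>\<^sup>2 + b * (\<phi> * p (n - r))) * E r + p (n - r) * a * E' + \<psi> * (P (n - r) * E r) - \<psi> * (p (n - r) * z)"
      for a b z E' by (simp add: algebra_simps)
    show ?thesis unfolding gen e PP p by (simp add: algebra_simps)
  qed
  then have "(\<Sum>r\<le>n. P (n - r) * (\<phi>\<^sup>2 + \<psi>) * E r + p (n - r) * ((of_nat r + 1) * (of_nat r + 1 / 2) * E (Suc r) + (2 * of_nat r + 1 / 2) * \<phi> * E r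
        - \<psi> * (case r of 0 \<Rightarrow> 0 | Suc j \<Rightarrow> E j))) =
      (\<Sum>r\<le>n. ?c r * (p (Suc n - r) * E r) + p (n - r) * ((of_nat r + 1) * (of_nat r + 1 / 2)) * E (Suc r)
      + \<psi> * (P (n - r) * E r) - \<psi> * (p (n - r) * (case r of 0 \<Rightarrow> 0 | Suc j \<Rightarrow> E j)))"
    by (intro sum.cong refl) simp_all
  also have "\<dots> = (\<Sum>r\<le>n. ?c r * (p (Suc n - r) * E r)) + (\<Sum>r\<le>n. p (n - r) * ((of_nat r + 1) * (of_nat r + 1 / 2)) * E (Suc r))
      + \<psi> * (\<Sum>r\<le>n. P (n - r) * E r) - \<psi> * (\<Sum>r\<le>n. p (n - r) * (case r of 0 \<Rightarrow> 0 | Suc j \<Rightarrow> E j))"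
    by (simp only: sum.distrib sum_subtractf sum_distrib_left)
  also have "\<dots> = (\<Sum>r\<le>n. ?c r * (p (Suc n - r) * E r)) + (\<Sum>r\<le>Suc n. ?d r * (p (Suc n - r) * E r))"
    by (simp only: 1 0 add_diff_eq[symmetric] add_0_right)
  also have "\<dots> = (\<Sum>r\<le>n. (?c r + ?d r) * (p (Suc n - r) * E r)) + ?d (Suc n) * (p 0 * E (Suc n))"
    by (simp add: sum.distrib distrib_right)
  also have "(\<Sum>r\<le>n. (?c r + ?d r) * (p (Suc n - r) * E r)) = (\<Sum>r\<le>n. (of_nat n + 1) * (of_nat n + 1 / 2) * (p (Suc n - r) * E r))"
    by (rule sum.cong) (simp_all add: of_nat_diff field_simps)
  also have "?d (Suc n) = (of_nat n + 1) * (of_nat n + 1 / 2)" by (simp add: field_simps)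
  finally show ?thesis by (simp add: P_def sum_distrib_left distrib_left)
qed

text \<open>The coefficient of \<open>z ^ n\<close> in the product of
  \<open>exp (conn x * z)\<close> and the generating series of \<open>serre r x\<close>.\<close>

definition taylor_sum :: "nat \<Rightarrow> complex \<Rightarrow> complex" where
  "taylor_sum n x = (\<Sum>r\<le>n. conn x ^ (n - r) / fact (n - r) * serre r x)"

lemma taylor_sum_deriv:
  assumes x: "0 < Re x"
  shows "(taylor_sum n has_field_derivative (of_nat n + 1) * (of_nat n + 1 / 2) * taylor_sum (Suc n) x) (at x)"
proof -
  define p where "p k = conn x ^ k / fact k" for k
  have pd: "((\<lambda>x. conn x ^ k / fact k) has_field_derivative
      (case k of 0 \<Rightarrow> 0 | Suc j \<Rightarrow> p j) * ((conn x)\<^sup>2 + curv x)) (at x)" for k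
  proof (cases k)
    case (Suc j)
    have "((\<lambda>x. conn x ^ k / fact k) has_field_derivative
        of_nat k * (((conn x)\<^sup>2 + curv x) * conn x ^ (k - Suc 0)) / fact k) (at x)"
      by (rule DERIV_cdivide[OF DERIV_power[OF conn_deriv[OF x]]])
    moreover have "of_nat k * (c * conn x ^ (k - Suc 0)) / fact k = p j * c" for c
      by (simp add: Suc p_def divide_simps del: of_nat_Suc)
    ultimately show ?thesis by (simp add: Suc)
  qed simp
  have p: "conn x * p k = (of_nat k + 1) * p (Suc k)" for k
  proof -
    have "(of_nat k + 1 :: complex) \<noteq> 0" by (metis of_nat_Suc of_nat_eq_0_iff nat.distinct(1) add.commute)
    then have "w / f = (of_nat k + 1) * (w / ((of_nat k + 1) * f))" for w f :: complex by simp
    moreover have "p (Suc k) = conn x * conn x ^ k / ((of_nat k + 1) * fact k)"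
      by (simp add: p_def add.commute)
    ultimately show ?thesis by (metis p_def times_divide_eq_right)
  qed
  have "(taylor_sum n has_field_derivative
    (\<Sum>r\<le>n. (case n - r of 0 \<Rightarrow> 0 | Suc j \<Rightarrow> p j) * ((conn x)\<^sup>2 + curv x) * serre r x +
      p (n - r) * ((of_nat r + 1) * (of_nat r + 1 / 2) * serre (Suc r) x + (2 * of_nat r + 1 / 2) * conn x * serre r x
        - curv x * (case r of 0 \<Rightarrow> 0 | Suc j \<Rightarrow> serre j x)))) (at x)"
    unfolding taylor_sum_def[abs_def]
    by (rule DERIV_sum) (use DERIV_mult[OF pd serre_deriv[OF x]] in \<open>simp add: p_def mult_ac\<close>)
  also have "(\<Sum>r\<le>n. (case n - r of 0 \<Rightarrow> 0 | Suc j \<Rightarrow> p j) * ((conn x)\<^sup>2 + curv x) * serre r x +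
      p (n - r) * ((of_nat r + 1) * (of_nat r + 1 / 2) * serre (Suc r) x + (2 * of_nat r + 1 / 2) * conn x * serre r x
        - curv x * (case r of 0 \<Rightarrow> 0 | Suc j \<Rightarrow> serre j x))) =
      (of_nat n + 1) * (of_nat n + 1 / 2) * taylor_sum (Suc n) x"
    by (subst taylor_sum_identity[OF p]) (simp add: taylor_sum_def p_def)
  finally show ?thesis .
qed

text \<open>The prefactor is the product of the factors \<open>(j + 1) * (j + 1 / 2)\<close>,
  \<open>j < n\<close>, collected from \<open>taylor_sum_deriv\<close>.\<close>

lemma higher_deriv_theta3:
  "0 < Re x \<Longrightarrow> (deriv ^^ n) theta3 x = fact (2 * n) / 4 ^ n * taylor_sum n x"
proof (induction n arbitrary: x)
  case 0
  then show ?case by (simp add: taylor_sum_def serre_def)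
next
  case (Suc n)
  note x = Suc.prems
  have "((\<lambda>x. fact (2 * n) / 4 ^ n * taylor_sum n x) has_field_derivative
      fact (2 * n) / 4 ^ n * ((of_nat n + 1) * (of_nat n + 1 / 2) * taylor_sum (Suc n) x)) (at x)"
    by (rule DERIV_cmult[OF taylor_sum_deriv[OF x]])
  then have "((deriv ^^ n) theta3 has_field_derivative
      fact (2 * n) / 4 ^ n * ((of_nat n + 1) * (of_nat n + 1 / 2) * taylor_sum (Suc n) x)) (at x)"
    by (rule has_field_derivative_transform_within_open[where S = rhp]) (use x Suc.IH in auto)
  then have "(deriv ^^ Suc n) theta3 x = fact (2 * n) / 4 ^ n * ((of_nat n + 1) * (of_nat n + 1 / 2) * taylor_sum (Suc n) x)"
    by (simp add: DERIV_imp_deriv)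
  also have "\<dots> = fact (2 * Suc n) / 4 ^ Suc n * taylor_sum (Suc n) x"
    by (simp add: field_simps)
  finally show ?case .
qed

lemma serre_1_odd:
  assumes "odd n"
  shows "serre n 1 = 0"
proof -
  have "ratio_y 1 = 0" by (simp add: ratio_y_def theta2_1)
  then show ?thesis
    using theta_poly_parity[of 0 n] assms by (simp add: serre_def poly_0_coeff_0 coeff_map_poly)
qed

text \<open>The power \<open>2 ^ (n div 2)\<close> that made the polynomials integral is
  \<open>2 ^ k\<close> for \<open>n = 2 * k\<close>, exactly the denominator of
  \<open>Omega ^ k\<close>.\<close>

lemma serre_1_even:
  "serre (2 * k) 1 = theta3 1 * of_int (coeff (theta_poly (2 * k)) 0) * of_real Omega ^ k / fact (4 * k)"
proof -
  have y: "ratio_y 1 = 0" by (simp add: ratio_y_def theta2_1)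
  have Om: "complex_of_real Omega = (of_real pi)\<^sup>2 * theta3 1 ^ 8 / 2"
    using theta3_of_real[of 1] by (simp add: Omega_conv_theta3)
  have "complex_of_real Omega ^ k = (of_real pi) ^ (2 * k) * theta3 1 ^ (8 * k) / 2 ^ k"
    unfolding Om by (simp add: power_mult_distrib power_divide power_mult)
  then show ?thesis
    by (simp add: serre_def y poly_0_coeff_0 coeff_map_poly mult_ac)
qed

lemma sum_even_indices:
  fixes f :: "nat \<Rightarrow> complex"
  assumes "\<And>r. odd r \<Longrightarrow> f r = 0"
  shows "(\<Sum>r\<le>n. f r) = (\<Sum>k = 0..n div 2. f (2 * k))"
proof -
  have "(\<Sum>k = 0..n div 2. f (2 * k)) = sum f ((\<lambda>k. 2 * k) ` {0..n div 2})"
    by (subst sum.reindex) (auto simp: inj_on_def)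
  also have "\<dots> = sum f {..n}"
  proof (rule sum.mono_neutral_left)
    show "\<forall>r\<in>{..n} - (\<lambda>k. 2 * k) ` {0..n div 2}. f r = 0"
    proof
      fix r assume r: "r \<in> {..n} - (\<lambda>k. 2 * k) ` {0..n div 2}"
      have "odd r"
      proof
        assume "even r"
        then have "r = 2 * (r div 2)" "r div 2 \<in> {0..n div 2}" using r by (auto intro: div_le_mono)
        then show False using r by blast
      qed
      then show "f r = 0" by (rule assms)
    qed
  qed auto
  finally show ?thesis by simp
qed

theorem theorem1:
  "\<exists>d :: nat \<Rightarrow> int.
     d 0 = 1 \<and> d 1 = 1 \<and> d 2 = - 1 \<and> d 3 = 51 \<and> d 4 = 849 \<and> d 5 = - 26199 \<and> d 6 = 1341999 \<and>
     (\<forall>n :: nat.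
        (deriv ^^ n) theta3 1 =
          theta3 1 * ((- 1) ^ n / 4 ^ n) *
            (\<Sum>k = 0..n div 2.
               fact (2 * n) / (2 ^ (n - 2 * k) * fact (4 * k) * fact (n - 2 * k)) *
                 of_int (d k) * of_real Omega ^ k))"
proof (intro exI conjI allI)
  let ?d = "\<lambda>k. coeff (theta_poly (2 * k)) 0"
  show "?d 0 = 1" "?d 1 = 1" "?d 2 = - 1" "?d 3 = 51" "?d 4 = 849" "?d 5 = - 26199" "?d 6 = 1341999"
    using theta_poly_values by simp_all
  fix n :: nat
  \<comment> \<open>The powers of this value contribute \<open>(- 1) ^ n / 2 ^ (n - 2 * k)\<close>;
    the sign does not depend on \<open>k\<close> because \<open>2 * k\<close> is even.\<close>
  have c: "conn 1 = - 1 / 2" by (simp add: conn_def logderiv_theta3_1)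
  have "(deriv ^^ n) theta3 1 = fact (2 * n) / 4 ^ n * taylor_sum n 1"
    by (rule higher_deriv_theta3) simp
  also have "taylor_sum n 1 = (\<Sum>k = 0..n div 2. conn 1 ^ (n - 2 * k) / fact (n - 2 * k) * serre (2 * k) 1)"
    unfolding taylor_sum_def by (rule sum_even_indices) (simp add: serre_1_odd)
  also have "\<dots> = (\<Sum>k = 0..n div 2. theta3 1 * (- 1) ^ n * (1 / (2 ^ (n - 2 * k) * fact (4 * k) * fact (n - 2 * k)) * of_int (?d k) * of_real Omega ^ k))"
  proof (rule sum.cong)
    fix k assume "k \<in> {0..n div 2}"
    then have "2 * k \<le> n" by auto
    then have "(- 1 :: complex) ^ (n - 2 * k) = (- 1) ^ n"
      using power_add[of "- 1 :: complex" "n - 2 * k" "2 * k"] by simp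
    then have "conn 1 ^ (n - 2 * k) = (- 1) ^ n / 2 ^ (n - 2 * k)"
      by (simp only: c power_divide)
    then show "conn 1 ^ (n - 2 * k) / fact (n - 2 * k) * serre (2 * k) 1 =
        theta3 1 * (- 1) ^ n * (1 / (2 ^ (n - 2 * k) * fact (4 * k) * fact (n - 2 * k)) * of_int (?d k) * of_real Omega ^ k)"
      unfolding serre_1_even by (simp add: mult_ac)
  qed simp
  also have "\<dots> = theta3 1 * (- 1) ^ n * (\<Sum>k = 0..n div 2. 1 / (2 ^ (n - 2 * k) * fact (4 * k) * fact (n - 2 * k)) * of_int (?d k) * of_real Omega ^ k)"
    by (simp only: sum_distrib_left)
  finally show "(deriv ^^ n) theta3 1 =
          theta3 1 * ((- 1) ^ n / 4 ^ n) *
            (\<Sum>k = 0..n div 2.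
               fact (2 * n) / (2 ^ (n - 2 * k) * fact (4 * k) * fact (n - 2 * k)) *
                 of_int (?d k) * of_real Omega ^ k)"
    by (simp add: sum_distrib_left mult_ac)
qed

end
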